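(* Let $T_n$ be a $2$-dimensional determinantal hypertree on $n$ vertices. The random variable \[\frac{\mathrm{mg}(H_1(T_n,\mathbb{Z}))}{n^2}\] converges to zero in probability as $n\to\infty$.
   Context: For a group $\Gamma$, $\mathrm{mg}(\Gamma)$ denotes the minimum number of generators of $\Gamma$. A $2$-dimensional simplicial complex $S$ on the vertex set $[n]=\{1,\dots,n\}$ is called a ($2$-dimensional) hypertree if (a) $S$ has complete $1$-skeleton (all vertices and all edges of the complete graph on $[n]$ are in $S$); (b) the number of triangular faces of $S$ is $\binom{n-1}{2}$; (c) the homology group $H_1(S,\mathbb{Z})$ is finite. By Kalai's formula, $\sum_S |H_1(S,\mathbb{Z})|^2=n^{\binom{n-2}{2}}$, where the sum is over all hypertrees $S$ on $[n]$. The ($2$-dimensional) determinantal hypertree $T_n$ on $n$ vertices is the random hypertree on $[n]$ which equals $S$ with probability $|H_1(S,\mathbb{Z})|^2/n^{\binom{n-2}{2}}$ for each hypertree $S$. *)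

theory Defs
  imports "HOL-Algebra.Free_Abelian_Groups" "HOL-Probability.Probability"
begin

section \<open>Abstract simplicial complexes and simplicial homology\<close>

text \<open>A complex is the set of its nonempty faces. Every element of \<open>V\<close> is a vertex.\<close>

definition simplicial_complex_on :: "'v set \<Rightarrow> 'v set set \<Rightarrow> bool" where
  "simplicial_complex_on V K \<longleftrightarrow>
     (\<forall>\<sigma>\<in>K. finite \<sigma> \<and> \<sigma> \<noteq> {} \<and> \<sigma> \<subseteq> V) \<and>
     (\<forall>v\<in>V. {v} \<in> K) \<and>
     (\<forall>\<sigma>\<in>K. \<forall>\<tau>. \<tau> \<noteq> {} \<longrightarrow> \<tau> \<subseteq> \<sigma> \<longrightarrow> \<tau> \<in> K)"

definition faces :: "nat \<Rightarrow> 'v set set \<Rightarrow> 'v set set" where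
  "faces p K = {\<sigma> \<in> K. card \<sigma> = p + 1}"

definition simplicial_chain_group :: "nat \<Rightarrow> 'v set set \<Rightarrow> ('v set \<Rightarrow>\<^sub>0 int) monoid" where
  "simplicial_chain_group p K = free_Abelian_group (faces p K)"

text \<open>Each face is oriented by the order of its vertices: the boundary of a face
  \<open>v\<^sub>0 < \<dots> < v\<^sub>p\<close> is the sum over \<open>i\<close> of \<open>(-1)\<^sup>i\<close> times the face with \<open>v\<^sub>i\<close> omitted.
  In degree 0 the boundary is 0, so homology is unreduced.\<close>

definition simplicial_boundary ::
    "nat \<Rightarrow> ('v::linorder set \<Rightarrow>\<^sub>0 int) \<Rightarrow> ('v set \<Rightarrow>\<^sub>0 int)" where
  "simplicial_boundary p c =
     (if p = 0 then 0
      else frag_extend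
        (\<lambda>\<sigma>. \<Sum>i\<le>p. frag_cmul ((-1) ^ i) (frag_of (\<sigma> - {sorted_list_of_set \<sigma> ! i}))) c)"

definition simplicial_cycle_group ::
    "nat \<Rightarrow> 'v::linorder set set \<Rightarrow> ('v set \<Rightarrow>\<^sub>0 int) monoid" where
  "simplicial_cycle_group p K =
     subgroup_generated (simplicial_chain_group p K)
       {c \<in> carrier (simplicial_chain_group p K). simplicial_boundary p c = 0}"

definition simplicial_homology_group ::
    "nat \<Rightarrow> 'v::linorder set set \<Rightarrow> ('v set \<Rightarrow>\<^sub>0 int) set monoid" where
  "simplicial_homology_group p K =
     simplicial_cycle_group p K Mod
       (simplicial_boundary (Suc p) ` carrier (simplicial_chain_group (Suc p) K))"

section \<open>Minimum number of generators\<close>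

text \<open>Meaningful for finitely generated groups only.\<close>

definition min_generators :: "('a, 'b) monoid_scheme \<Rightarrow> nat" where
  "min_generators G =
     (LEAST m. \<exists>A. A \<subseteq> carrier G \<and> finite A \<and> card A = m \<and> generate G A = carrier G)"

section \<open>Hypertrees\<close>

text \<open>For \<open>n \<ge> 3\<close> a hypertree has a triangular face, so the bound \<open>card \<sigma> \<le> 3\<close> makes its
  dimension exactly 2; for \<open>n = 1, 2\<close> the only hypertree is the full simplex.\<close>

definition hypertrees :: "nat \<Rightarrow> nat set set set" where
  "hypertrees n =
     {S. simplicial_complex_on {1..n} S \<and> (\<forall>\<sigma>\<in>S. card \<sigma> \<le> 3) \<and>
         (\<forall>e. e \<subseteq> {1..n} \<and> card e = 2 \<longrightarrow> e \<in> S) \<and>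
         card (faces 2 S) = (n - 1) choose 2 \<and>
         finite (carrier (simplicial_homology_group 1 S))}"

definition determinantal_hypertree ::
    "nat \<Rightarrow> 'a measure \<Rightarrow> ('a \<Rightarrow> nat set set) \<Rightarrow> bool" where
  "determinantal_hypertree n M T \<longleftrightarrow>
     prob_space M \<and> T \<in> measurable M (count_space (hypertrees n)) \<and>
     (\<forall>S \<in> hypertrees n.
        measure M {\<omega> \<in> space M. T \<omega> = S} =
          real (card (carrier (simplicial_homology_group 1 S))) ^ 2 / real n ^ ((n - 2) choose 2))"

section \<open>Convergence in probability to a constant\<close>

text \<open>The variables may live on different probability spaces.\<close>

definition tends_in_probability ::
    "(nat \<Rightarrow> 'a measure) \<Rightarrow> (nat \<Rightarrow> 'a \<Rightarrow> real) \<Rightarrow> real \<Rightarrow> bool" where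
  "tends_in_probability M X c \<longleftrightarrow>
     (\<forall>\<epsilon>>0. (\<lambda>n. measure (M n) {\<omega> \<in> space (M n). \<bar>X n \<omega> - c\<bar> > \<epsilon>}) \<longlonglongrightarrow> 0)"

end

theory Submission
  imports Defs "Jordan_Normal_Form.Determinant" "HOL-Real_Asymp.Real_Asymp"
begin

text \<open>Dropping the edges at vertex 1 identifies \<open>H\<^sub>1(S)\<close> with the cokernel of a square integer
  matrix with columns indexed by the triangles of \<open>S\<close>. A greedy choice of generators gives,
  for every \<open>P\<close>, the bound \<open>mg(H\<^sub>1(S)) \<le> log\<^sub>2 Z + log\<^bsub>P+1\<^esub> \<bar>H\<^sub>1(S)\<bar>\<close>, where \<open>Z\<close> is the number of
  1-cocycles of \<open>S\<close> modulo \<open>P!\<close> vanishing at vertex 1. By Hadamard's inequality the second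
  term is at most \<open>n\<^sup>2 log 3 / (4 log (P+1))\<close>.

  It remains to see that the expectation of \<open>Z\<close> is \<open>exp(o(n\<^sup>2))\<close> for each fixed modulus \<open>m\<close>. The
  Cauchy-Binet formula and Hadamard's inequality bound the probability that a given cochain \<open>f\<close>
  is a cocycle of \<open>T\<^sub>n\<close> by \<open>exp(o(n\<^sup>2))\<close> times the product over the edges \<open>e\<close> of \<open>deg\<^sub>f(e) / n\<close>,
  where \<open>deg\<^sub>f(e)\<close> counts the vertices \<open>v\<close> such that \<open>f\<close> is closed on \<open>e \<union> {v}\<close>. This
  fraction is the probability that a random vertex predicts \<open>f(e)\<close> correctly from the other values of
  \<open>f\<close>. A bounded sample of vertices predicts nearly as well, and for such predictions the sum over all
  \<open>f\<close> is at most the number of values of \<open>f\<close> on the \<open>O(n)\<close> edges touching the sample.\<close>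

section \<open>Gram determinants and minors\<close>

text \<open>The modulus m must stay fixed while n grows: with samples of size K the cocycle count
  loses a factor exp(N m / (K + 1)) * n^K * m^(K n), N being the number of edges away from vertex 1,
  and the exponent is a small multiple of n^2 plus o(n^2) only if K is fixed and large compared with
  m. Torsion of large order is therefore charged to the determinant, which is at most 3^(N/2) in
  absolute value. A factorial separates the two kinds of torsion since every r \<le> P divides P!.
  Hadamard's inequality yields the factor n^N with N = C(n-1,2), while the normalization is
  n^C(n-2,2); the quotient n^(n-2) is harmless on the scale exp(n^2). The obstacle in the sum over f
  is that each factor predicts f(e) from the rest of f, so the product over e is not a probability
  weight on cochains and need not sum to at most 1. Predictions from a fixed sample depend, apart
  from f(e) itself, on a common set of O(K n) coordinates; once these are fixed, the remaining
  coordinates decouple and their weights do sum to at most 1.\<close>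

lemma orthogonal_decomposition:
  fixes r :: "nat \<Rightarrow> 'a \<Rightarrow> real"
  assumes "finite A"
  shows "\<exists>q L. \<forall>i<N. (\<forall>a. r i a = q i a + (\<Sum>j<i. L i j * q j a)) \<and>
                  (\<forall>j<i. (\<Sum>a\<in>A. q i a * q j a) = 0)"
proof (induction N)
  case (Suc N)
  then obtain q L where
    dec: "\<And>i a. i < N \<Longrightarrow> r i a = q i a + (\<Sum>j<i. L i j * q j a)" and
    orth: "\<And>i j. i < N \<Longrightarrow> j < i \<Longrightarrow> (\<Sum>a\<in>A. q i a * q j a) = 0"
    by blast
  \<comment> \<open>Gram-Schmidt without normalization. Dependent rows are allowed: if
    \<open>q j\<close> has norm 0 on \<open>A\<close>, the quotient is 0 by convention, and since
    \<open>q j\<close> then vanishes on \<open>A\<close>, any coefficient preserves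
    orthogonality.\<close>
  define c where "c j = (\<Sum>a\<in>A. r N a * q j a) / (\<Sum>a\<in>A. q j a * q j a)" for j
  define q' where "q' = q(N := (\<lambda>a. r N a - (\<Sum>j<N. c j * q j a)))"
  define L' where "L' = L(N := c)"
  have orth': "(\<Sum>a\<in>A. q l a * q j a) = 0" if "l < N" "j < N" "l \<noteq> j" for l j
    using orth[of l j] orth[of j l] that by (cases "l < j") (auto simp: mult.commute)
  have new: "(\<Sum>a\<in>A. (r N a - (\<Sum>l<N. c l * q l a)) * q j a) = 0" if "j < N" for j
  proof -
    have "(\<Sum>a\<in>A. (\<Sum>l<N. c l * q l a) * q j a) = (\<Sum>l<N. c l * (\<Sum>a\<in>A. q l a * q j a))"
      by (simp add: sum_distrib_right sum_distrib_left mult.assoc) (rule sum.swap)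
    also have "\<dots> = (\<Sum>l<N. if l = j then c j * (\<Sum>a\<in>A. q j a * q j a) else 0)"
      using orth' that by (intro sum.cong) auto
    also have "\<dots> = c j * (\<Sum>a\<in>A. q j a * q j a)"
      using that by simp
    also have "\<dots> = (\<Sum>a\<in>A. r N a * q j a)"
    proof (cases "(\<Sum>a\<in>A. q j a * q j a) = 0")
      case True
      then have "\<forall>a\<in>A. q j a * q j a = 0"
        using assms by (subst (asm) sum_nonneg_eq_0_iff) auto
      then show ?thesis by simp
    qed (simp add: c_def)
    finally show ?thesis
      by (simp add: left_diff_distrib sum_subtractf)
  qed
  have "(\<forall>a. r i a = q' i a + (\<Sum>j<i. L' i j * q' j a)) \<and> (\<forall>j<i. (\<Sum>a\<in>A. q' i a * q' j a) = 0)"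
    if "i < Suc N" for i
    using that dec orth new by (cases "i = N") (auto simp: q'_def L'_def intro!: sum.cong)
  then show ?case by blast
qed auto

text \<open>Gram-Schmidt factors the Gram matrix as \<open>l\<close>, a diagonal matrix
  \<open>D\<close> and the transpose of \<open>l\<close>, where \<open>l\<close> is unit lower
  triangular. The determinant is thus the product of the squared norms of the \<open>q i\<close>,
  and \<open>r i\<close> is \<open>q i\<close> plus orthogonal components, hence at least as
  long.\<close>

lemma hadamard_gram:
  fixes r :: "nat \<Rightarrow> 'a \<Rightarrow> real"
  assumes A: "finite A"
  shows "Determinant.det (Matrix.mat N N (\<lambda>(i,j). \<Sum>a\<in>A. r i a * r j a)) \<le> (\<Prod>i<N. \<Sum>a\<in>A. (r i a)\<^sup>2)"
proof -
  obtain q L where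
    dec: "\<And>i a. i < N \<Longrightarrow> r i a = q i a + (\<Sum>j<i. L i j * q j a)" and
    orth: "\<And>i j. i < N \<Longrightarrow> j < i \<Longrightarrow> (\<Sum>a\<in>A. q i a * q j a) = 0"
    using orthogonal_decomposition[OF A, of N r] by blast
  define l where "l i j = (if j < i then L i j else if j = i then 1 else 0)" for i j
  define D where "D i = (\<Sum>a\<in>A. (q i a)\<^sup>2)" for i
  have D0: "D i \<ge> 0" for i unfolding D_def by (simp add: sum_nonneg)
  have r: "r i a = (\<Sum>p<N. l i p * q p a)" if "i < N" for i a
  proof -
    have "(\<Sum>p<N. l i p * q p a) = (\<Sum>p\<in>{..<Suc i}. l i p * q p a)"
      using that by (intro sum.mono_neutral_right) (auto simp: l_def)
    also have "\<dots> = r i a"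
      using dec[OF that] by (simp add: l_def)
    finally show ?thesis by simp
  qed
  have orth': "(\<Sum>a\<in>A. q p a * q p' a) = (if p = p' then D p else 0)" if "p < N" "p' < N" for p p'
    using orth[of p p'] orth[of p' p] that
    by (cases p p' rule: linorder_cases) (auto simp: mult.commute D_def power2_eq_square)
  have gram: "(\<Sum>a\<in>A. r i a * r j a) = (\<Sum>p<N. l i p * D p * l j p)" if "i < N" "j < N" for i j
  proof -
    have "(\<Sum>a\<in>A. r i a * r j a) = (\<Sum>a\<in>A. \<Sum>p<N. \<Sum>p'<N. l i p * q p a * (l j p' * q p' a))"
      by (simp add: r that sum_product)
    also have "\<dots> = (\<Sum>p<N. \<Sum>p'<N. \<Sum>a\<in>A. l i p * q p a * (l j p' * q p' a))"
      by (subst sum.swap) (intro sum.cong refl, rule sum.swap)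
    also have "\<dots> = (\<Sum>p<N. \<Sum>p'<N. l i p * l j p' * (\<Sum>a\<in>A. q p a * q p' a))"
      by (simp add: sum_distrib_left mult_ac)
    also have "\<dots> = (\<Sum>p<N. l i p * D p * l j p)"
    proof (rule sum.cong)
      fix p assume "p \<in> {..<N}"
      then have "(\<Sum>p'<N. l i p * l j p' * (\<Sum>a\<in>A. q p a * q p' a))
           = (\<Sum>p'<N. if p = p' then l i p * l j p' * D p else 0)"
        by (intro sum.cong) (auto simp: orth')
      also have "\<dots> = l i p * l j p * D p"
        using \<open>p \<in> {..<N}\<close> by simp
      finally show "(\<Sum>p'<N. l i p * l j p' * (\<Sum>a\<in>A. q p a * q p' a)) = l i p * D p * l j p"
        by simp
    qed simp
    finally show ?thesis .
  qed
  define B where "B = Matrix.mat N N (\<lambda>(i,p). l i p * D p)"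
  define C where "C = Matrix.mat N N (\<lambda>(i,p). l i p)"
  have B: "B \<in> carrier_mat N N" and C: "C \<in> carrier_mat N N" by (auto simp: B_def C_def)
  have "Matrix.mat N N (\<lambda>(i,j). \<Sum>a\<in>A. r i a * r j a) = B * transpose_mat C"
    by (rule eq_matI) (auto simp: B_def C_def gram scalar_prod_def atLeast0LessThan intro!: sum.cong)
  then have "Determinant.det (Matrix.mat N N (\<lambda>(i,j). \<Sum>a\<in>A. r i a * r j a))
       = Determinant.det B * Determinant.det C"
    using B C by (simp add: det_mult det_transpose)
  also have "Determinant.det B = (\<Prod>i<N. D i)"
    by (subst det_lower_triangular[OF _ B])
       (auto simp: B_def l_def prod_list_diag_prod atLeast0LessThan)
  also have "Determinant.det C = 1"
    by (subst det_lower_triangular[OF _ C])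
       (auto simp: C_def l_def prod_list_diag_prod)
  also have "(\<Prod>i<N. D i) * 1 \<le> (\<Prod>i<N. \<Sum>a\<in>A. (r i a)\<^sup>2)"
    unfolding mult_1_right
  proof (rule prod_mono, safe)
    fix i assume "i < N"
    have "D i = l i i * D i * l i i" by (simp add: l_def)
    also have "\<dots> \<le> (\<Sum>p<N. l i p * D p * l i p)"
    proof (rule member_le_sum)
      fix p
      have "l i p * D p * l i p = (l i p)\<^sup>2 * D p" by (simp add: power2_eq_square)
      then show "0 \<le> l i p * D p * l i p" by (simp only:) (simp add: D0)
    qed (use \<open>i < N\<close> in auto)
    also have "\<dots> = (\<Sum>a\<in>A. (r i a)\<^sup>2)"
      using gram[of i i] \<open>i < N\<close> by (simp add: power2_eq_square)
    finally show "D i \<le> (\<Sum>a\<in>A. (r i a)\<^sup>2)" .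
  qed (simp add: D0)
  finally show ?thesis .
qed

lemma permutes_less: "p permutes {0..<n::nat} \<Longrightarrow> i < n \<Longrightarrow> p i < n"
  using permutes_in_image[of p "{0..<n}" i] by simp

text \<open>The Cauchy-Binet formula, summed over tuples of columns instead of subsets: a tuple with
  a repetition has determinant 0, and each subset is counted once for every ordering, hence
  \<open>fact N\<close>. Sums over tuples have the advantage that they factorize over the
  coordinates.\<close>

lemma sum_squared_minors:
  fixes r :: "nat \<Rightarrow> 'a \<Rightarrow> 'b::{comm_ring_1,ring_char_0}"
  assumes A: "finite A"
  shows "(\<Sum>s\<in>PiE {..<N} (\<lambda>_. A). (Determinant.det (Matrix.mat N N (\<lambda>(i,j). r i (s j))))\<^sup>2)
       = fact N * Determinant.det (Matrix.mat N N (\<lambda>(i,j). \<Sum>a\<in>A. r i a * r j a))"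
proof -
  let ?P = "{p. p permutes {0..<N}}"
  let ?G = "\<lambda>i j. \<Sum>a\<in>A. r i a * r j a"
  have det: "Determinant.det (Matrix.mat N N (\<lambda>(i,j). r i (s j)))
      = (\<Sum>p\<in>?P. signof p * (\<Prod>j<N. r (p j) (s j)))" for s :: "nat \<Rightarrow> 'a"
    by (subst det_col[of _ N])
       (auto intro!: sum.cong prod.cong arg_cong2[of _ _ _ _ "(*)"] simp: permutes_less)
  have "(\<Sum>s\<in>PiE {..<N} (\<lambda>_. A). (Determinant.det (Matrix.mat N N (\<lambda>(i,j). r i (s j))))\<^sup>2)
      = (\<Sum>s\<in>PiE {..<N} (\<lambda>_. A). \<Sum>p\<in>?P. \<Sum>q\<in>?P.
            signof p * signof q * (\<Prod>j<N. r (p j) (s j) * r (q j) (s j)))"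
    unfolding det power2_eq_square sum_product prod.distrib
    by (intro sum.cong refl) (simp add: mult_ac)
  also have "\<dots> = (\<Sum>p\<in>?P. \<Sum>q\<in>?P. \<Sum>s\<in>PiE {..<N} (\<lambda>_. A).
            signof p * signof q * (\<Prod>j<N. r (p j) (s j) * r (q j) (s j)))"
    by (subst sum.swap) (intro sum.cong refl, rule sum.swap)
  also have "\<dots> = (\<Sum>p\<in>?P. \<Sum>q\<in>?P. signof p * signof q * (\<Prod>j<N. ?G (p j) (q j)))"
    using A by (simp add: prod_sum_PiE sum_distrib_left)
  also have "\<dots> = (\<Sum>p\<in>?P. signof p * (signof p * Determinant.det (Matrix.mat N N (\<lambda>(i,j). ?G i j))))"
  proof (rule sum.cong)
    fix p assume p: "p \<in> ?P"
    \<comment> \<open>For fixed \<open>p\<close> the sum over \<open>q\<close> is the determinant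
      with its rows permuted by \<open>p\<close>. The resulting sign cancels the other
      \<open>signof p\<close>, so all permutations \<open>p\<close> contribute equally.\<close>
    have "signof p * Determinant.det (Matrix.mat N N (\<lambda>(i,j). ?G i j))
        = Determinant.det (Matrix.mat N N (\<lambda>(i,j). Matrix.mat N N (\<lambda>(i,j). ?G i j) $$ (p i, j)))"
      using p by (intro det_permute_rows[symmetric]) auto
    also have "\<dots> = (\<Sum>q\<in>?P. signof q * (\<Prod>i<N. ?G (p i) (q i)))"
      using p by (subst det_def'[of _ N])
       (auto intro!: sum.cong prod.cong arg_cong2[of _ _ _ _ "(*)"] simp: permutes_less atLeast0LessThan)
    finally show "(\<Sum>q\<in>?P. signof p * signof q * (\<Prod>j<N. ?G (p j) (q j)))
      = signof p * (signof p * Determinant.det (Matrix.mat N N (\<lambda>(i,j). ?G i j)))"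
      by (simp add: sum_distrib_left mult.assoc)
  qed simp
  also have "\<dots> = (\<Sum>p\<in>?P. Determinant.det (Matrix.mat N N (\<lambda>(i,j). ?G i j)))"
    by (intro sum.cong) (auto simp: sign_def)
  also have "\<dots> = fact N * Determinant.det (Matrix.mat N N (\<lambda>(i,j). ?G i j))"
    by (simp add: card_permutations[OF refl])
  finally show ?thesis .
qed

section \<open>Predicting a function from a sample\<close>

text \<open>The factor \<open>c\<close> in the integrand replaces a division by \<open>c\<close>, so
  that \<open>c = 0\<close> is allowed: below, \<open>c\<close> is the size of a possibly empty
  set.\<close>

lemma has_integral_affine_power:
  fixes c d :: real
  shows "((\<lambda>t. c * (c * t + d) ^ b) has_integral ((c + d) ^ Suc b / real (Suc b) - d ^ Suc b / real (Suc b))) {0..1}"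
proof -
  have "((\<lambda>t. (c * t + d) ^ Suc b / real (Suc b)) has_real_derivative c * (c * t + d) ^ b) (at t within {0..1})" for t
    by (rule derivative_eq_intros refl | simp del: of_nat_Suc power_Suc)+
  then show ?thesis
    using fundamental_theorem_of_calculus[of 0 1 "\<lambda>t. (c * t + d) ^ Suc b / real (Suc b)" "\<lambda>t. c * (c * t + d) ^ b"]
    by (simp add: has_real_derivative_iff_has_vector_derivative del: of_nat_Suc power_Suc)
qed

text \<open>For p = |G| / |V| and B the number of hits among k independent uniform draws, this says
  p * E[1 / (B + 1)] \<le> 1 / (k + 1). Indeed 1 / (B + 1) is the integral of t^B over [0,1], and
  E[t^B] = (p t + 1 - p)^k.\<close>

lemma sum_inverse_count_le:
  assumes V: "finite V" and G: "G \<subseteq> V"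
  shows "(\<Sum>z\<in>PiE {..<k} (\<lambda>_. V). real (card G) / (real (card {j\<in>{..<k}. z j \<in> G}) + 1))
       \<le> real (card V) ^ Suc k / real (Suc k)"
proof -
  let ?Z = "PiE {..<k} (\<lambda>_. V)" and ?B = "\<lambda>z. card {j\<in>{..<k}. z j \<in> G}"
  let ?g = "real (card G)" and ?n = "real (card V)"
  have finG: "finite G" using V G finite_subset by blast
  have gn: "?g \<le> ?n" using V G by (simp add: card_mono)
  have gen: "(\<Sum>z\<in>?Z. t ^ ?B z) = (?g * t + (?n - ?g)) ^ k" for t :: real
  proof -
    have "(\<Sum>z\<in>?Z. t ^ ?B z) = (\<Sum>z\<in>?Z. \<Prod>j<k. if z j \<in> G then t else 1)"
      by (simp add: prod.If_cases Collect_conj_eq lessThan_def)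
    also have "\<dots> = (\<Prod>j<k. \<Sum>v\<in>V. if v \<in> G then t else 1)"
      using V by (subst prod_sum_PiE) auto
    also have "(\<Sum>v\<in>V. if v \<in> G then t else 1) = ?g * t + (?n - ?g)"
      using V G finG by (simp add: sum.If_cases Int_absorb1 card_Diff_subset of_nat_diff card_mono flip: Diff_eq)
    finally show ?thesis by simp
  qed
  have "((\<lambda>t. \<Sum>z\<in>?Z. ?g * t ^ ?B z) has_integral (\<Sum>z\<in>?Z. ?g * (1 / (real (?B z) + 1)))) {0..1}"
  proof (intro has_integral_sum has_integral_mult_right)
    fix z
    note has_integral_affine_power[of 1 0 "?B z"]
    then show "((\<lambda>t. t ^ ?B z) has_integral 1 / (real (?B z) + 1)) {0..1::real}"
      by (simp add: add.commute)
  qed (use V in \<open>auto intro: finite_PiE\<close>)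
  then have "((\<lambda>t. ?g * (?g * t + (?n - ?g)) ^ k) has_integral (\<Sum>z\<in>?Z. ?g * (1 / (real (?B z) + 1)))) {0..1}"
    by (simp only: gen flip: sum_distrib_left)
  then have "(\<Sum>z\<in>?Z. ?g * (1 / (real (?B z) + 1)))
      = (?g + (?n - ?g)) ^ Suc k / real (Suc k) - (?n - ?g) ^ Suc k / real (Suc k)"
    by (rule has_integral_unique[OF _ has_integral_affine_power])
  also have "\<dots> \<le> ?n ^ Suc k / real (Suc k)"
    using gn by simp
  finally show ?thesis by simp
qed

text \<open>For fixed values on \<open>T\<close> the sum over the other coordinates factorizes.\<close>

lemma sum_predictions_le:
  fixes w :: "'e \<Rightarrow> ('e \<Rightarrow> 'q) \<Rightarrow> real"
  assumes fin: "finite T" "finite U" "finite Q" and disj: "T \<inter> U = {}"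
    and nonneg: "\<And>e f. w e f \<ge> 0"
    and sub: "\<And>e f. e \<in> U \<Longrightarrow> (\<Sum>a\<in>Q. w e (f(e := a))) \<le> 1"
    and local: "\<And>e f f'. e \<in> U \<Longrightarrow> f e = f' e \<Longrightarrow> (\<And>e'. e' \<in> T \<Longrightarrow> f e' = f' e') \<Longrightarrow> w e f = w e f'"
  shows "(\<Sum>f\<in>PiE (T \<union> U) (\<lambda>_. Q). \<Prod>e\<in>U. w e f) \<le> real (card Q) ^ card T"
  using fin(2) disj sub local
proof (induction U rule: finite_induct)
  case empty
  show ?case using fin(1) by (simp add: card_PiE)
next
  case (insert u U)
  let ?P = "PiE (T \<union> U) (\<lambda>_. Q)"
  have u: "u \<notin> T \<union> U" using insert.hyps insert.prems(1) by auto
  have eq: "PiE (T \<union> insert u U) (\<lambda>_. Q) = (\<lambda>(a, f). f(u := a)) ` (Q \<times> ?P)"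
    by (simp add: PiE_insert_eq)
  have inj: "inj_on (\<lambda>(a, f). f(u := a)) (Q \<times> ?P)"
    by (rule inj_combinator[OF u])
  have "(\<Sum>f\<in>PiE (T \<union> insert u U) (\<lambda>_. Q). \<Prod>e\<in>insert u U. w e f)
      = (\<Sum>(a, f)\<in>Q \<times> ?P. \<Prod>e\<in>insert u U. w e (f(u := a)))"
    unfolding eq by (subst sum.reindex[OF inj]) (simp add: case_prod_beta)
  also have "\<dots> = (\<Sum>(a, f)\<in>Q \<times> ?P. w u (f(u := a)) * (\<Prod>e\<in>U. w e f))"
  proof (rule sum.cong)
    fix p assume "p \<in> Q \<times> ?P"
    obtain a f where p: "p = (a, f)" by (metis surj_pair)
    have "(\<Prod>e\<in>U. w e (f(u := a))) = (\<Prod>e\<in>U. w e f)"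
      using u by (intro prod.cong refl insert.prems(3)) auto
    then show "(case p of (a, f) \<Rightarrow> \<Prod>e\<in>insert u U. w e (f(u := a)))
        = (case p of (a, f) \<Rightarrow> w u (f(u := a)) * (\<Prod>e\<in>U. w e f))"
      using insert.hyps by (simp add: p)
  qed simp
  also have "\<dots> = (\<Sum>f\<in>?P. (\<Sum>a\<in>Q. w u (f(u := a))) * (\<Prod>e\<in>U. w e f))"
    by (subst sum.cartesian_product[symmetric], subst sum.swap) (simp add: sum_distrib_right)
  also have "\<dots> \<le> (\<Sum>f\<in>?P. 1 * (\<Prod>e\<in>U. w e f))"
    by (intro sum_mono mult_right_mono insert.prems(2) prod_nonneg) (auto simp: nonneg)
  also have "\<dots> \<le> real (card Q) ^ card T"
    unfolding mult_1
  proof (rule insert.IH)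
    show "T \<inter> U = {}" using insert.prems(1) by auto
    show "(\<Sum>a\<in>Q. w e (f(e := a))) \<le> 1" if "e \<in> U" for e f
      by (rule insert.prems(2)) (use that in auto)
    show "w e f = w e f'" if "e \<in> U" "f e = f' e" "\<And>e'. e' \<in> T \<Longrightarrow> f e' = f' e'" for e f f'
      by (rule insert.prems(3)) (use that in auto)
  qed
  finally show ?case .
qed

text \<open>Heuristically, the fraction of vertices that are good for \<open>e\<close> is the probability that
  a random vertex predicts the value \<open>f e\<close> from the rest of \<open>f\<close>. A sample \<open>z\<close> of \<open>k\<close> vertices
  predicts almost as well by the rule of succession, and it reads only the coordinates of \<open>f\<close>
  that touch the sample.\<close>

lemma sum_prod_good_fraction_le:
  fixes good :: "('e \<Rightarrow> 'q) \<Rightarrow> 'e \<Rightarrow> 'v \<Rightarrow> bool" and touch :: "'e \<Rightarrow> 'v \<Rightarrow> bool"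
  assumes fin: "finite I" "finite V" "finite Q" and Q: "Q \<noteq> {}" and V: "V \<noteq> {}"
    and unique: "\<And>f e v a b. e \<in> I \<Longrightarrow> v \<in> V \<Longrightarrow> a \<in> Q \<Longrightarrow> b \<in> Q \<Longrightarrow>
      good (f(e := a)) e v \<Longrightarrow> good (f(e := b)) e v \<Longrightarrow> a = b"
    and local: "\<And>f f' e v. e \<in> I \<Longrightarrow> v \<in> V \<Longrightarrow> f e = f' e \<Longrightarrow>
      (\<And>e'. e' \<in> I \<Longrightarrow> touch e' v \<Longrightarrow> f e' = f' e') \<Longrightarrow> good f e v = good f' e v"
    and degree: "\<And>v. v \<in> V \<Longrightarrow> card {e\<in>I. touch e v} \<le> card V"
  shows "(\<Sum>f\<in>PiE I (\<lambda>_. Q). \<Prod>e\<in>I. real (card {v\<in>V. good f e v}) / real (card V))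
     \<le> exp (real (card I) * real (card Q) / real (Suc k)) * real (card V) ^ k * real (card Q) ^ (k * card V)"
proof -
  define n where "n = card V"
  define m where "m = card Q"
  define Z where "Z = PiE {..<k} (\<lambda>_. V)"
  define cnt where "cnt z e f = card {j\<in>{..<k}. good f e (z j)}" for z e f
  \<comment> \<open>Laplace's estimate, from the sample \<open>z\<close>, of the chance that
    \<open>f e\<close> is predicted correctly. A sampled vertex supports at most one of the
    \<open>m\<close> values and each value gets a bonus of 1, so the estimates are positive and sum
    to at most 1 over the values of \<open>f e\<close>.\<close>
  define X where "X z e f = (real (cnt z e f) + 1) / (real k + real m)" for z e f
  define g where "g f e = card {v\<in>V. good f e v}" for f e
  have n: "n > 0" using fin V by (simp add: n_def card_gt_0_iff)
  have m: "m > 0" using fin Q by (simp add: m_def card_gt_0_iff)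
  have finZ: "finite Z" and cardZ: "card Z = n ^ k"
    using fin by (auto simp: Z_def n_def card_PiE intro: finite_PiE)
  have cnt_le: "cnt z e f \<le> k" for z e f
    unfolding cnt_def using card_mono[of "{..<k}" "{j\<in>{..<k}. good f e (z j)}"] by auto
  have X0: "X z e f > 0" for z e f unfolding X_def using m by (intro divide_pos_pos) auto
  have X1: "X z e f \<le> 1" for z e f unfolding X_def using m cnt_le[of z e f] by simp
  \<comment> \<open>The average ratio of the true fraction to its estimate is at most
    \<open>(k + m) / (k + 1)\<close>. Its excess over 1, at most \<open>m / (k + 1)\<close> per
    coordinate, ends up in the exponent.\<close>
  define C where "C = exp (real (card I) * real m / real (Suc k))"

  have pointwise: "(\<Prod>e\<in>I. real (g f e) / real n) \<le> C * (\<Sum>z\<in>Z. \<Prod>e\<in>I. X z e f)" for f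
  proof -
    define \<rho> where "\<rho> z e = (real (g f e) / real n) / X z e f" for z e
    have \<rho>: "(\<Sum>z\<in>Z. \<rho> z e) \<le> real n ^ k * ((real k + real m) / real (Suc k))" if "e \<in> I" for e
    proof -
      have "\<rho> z e = (real k + real m) / real n * (real (g f e) / (real (card {j\<in>{..<k}. z j \<in> {v\<in>V. good f e v}}) + 1))"
        if "z \<in> Z" for z
      proof -
        have "{j\<in>{..<k}. z j \<in> {v\<in>V. good f e v}} = {j\<in>{..<k}. good f e (z j)}"
          using that by (auto simp: Z_def)
        then show ?thesis by (simp add: \<rho>_def X_def cnt_def)
      qed
      then have "(\<Sum>z\<in>Z. \<rho> z e) = (real k + real m) / real n *
          (\<Sum>z\<in>Z. real (g f e) / (real (card {j\<in>{..<k}. z j \<in> {v\<in>V. good f e v}}) + 1))"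
        by (simp add: sum_distrib_left)
      also have "\<dots> \<le> (real k + real m) / real n * (real n ^ Suc k / real (Suc k))"
        unfolding Z_def g_def n_def using fin by (intro mult_left_mono sum_inverse_count_le) auto
      also have "\<dots> = real n ^ k * ((real k + real m) / real (Suc k))"
      proof -
        have "a / real n * (real n ^ Suc k / s) = real n ^ k * (a / s)" for a s :: real
          using n by simp
        then show ?thesis .
      qed
      finally show ?thesis .
    qed
    \<comment> \<open>By averaging, one sample serves all coordinates at once. It depends on
      \<open>f\<close>, which is why its product is then bounded by the sum over all samples; this
      costs the factor \<open>n ^ k\<close>.\<close>
    have "\<exists>z\<in>Z. (\<Sum>e\<in>I. \<rho> z e) \<le> real (card I) * ((real k + real m) / real (Suc k))"
    proof (rule ccontr)
      assume "\<not> ?thesis"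
      then have "(\<Sum>z\<in>Z. real (card I) * ((real k + real m) / real (Suc k))) < (\<Sum>z\<in>Z. \<Sum>e\<in>I. \<rho> z e)"
        using finZ cardZ n by (intro sum_strict_mono) (auto simp: not_le)
      also have "\<dots> = (\<Sum>e\<in>I. \<Sum>z\<in>Z. \<rho> z e)" by (rule sum.swap)
      also have "\<dots> \<le> (\<Sum>e\<in>I. real n ^ k * ((real k + real m) / real (Suc k)))"
        by (intro sum_mono \<rho>)
      finally show False by (simp add: cardZ mult_ac)
    qed
    then obtain z where z: "z \<in> Z" "(\<Sum>e\<in>I. \<rho> z e) \<le> real (card I) * ((real k + real m) / real (Suc k))"
      by blast
    have "(\<Prod>e\<in>I. real (g f e) / real n) = (\<Prod>e\<in>I. \<rho> z e * X z e f)"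
      using X0 by (intro prod.cong) (auto simp: \<rho>_def less_imp_neq[symmetric])
    also have "\<dots> = (\<Prod>e\<in>I. \<rho> z e) * (\<Prod>e\<in>I. X z e f)" by (rule prod.distrib)
    \<comment> \<open>The inequality \<open>x \<le> exp (x - 1)\<close> turns the product of the
      ratios into their sum and covers ratios equal to 0, for which a logarithm would not make
      sense.\<close>
    also have "(\<Prod>e\<in>I. \<rho> z e) \<le> (\<Prod>e\<in>I. exp (\<rho> z e - 1))"
    proof (rule prod_mono, safe)
      fix e
      show "0 \<le> \<rho> z e" using X0[of z e f] by (simp add: \<rho>_def)
      show "\<rho> z e \<le> exp (\<rho> z e - 1)" using exp_ge_add_one_self[of "\<rho> z e - 1"] by simp
    qed
    also have "(\<Prod>e\<in>I. exp (\<rho> z e - 1)) = exp ((\<Sum>e\<in>I. \<rho> z e) - real (card I))"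
      using fin by (simp add: exp_sum[symmetric] sum_subtractf)
    also have "\<dots> \<le> C"
    proof -
      have "real (card I) * ((real k + real m) / real (Suc k)) - real (card I)
          = real (card I) * ((real k + real m) / real (Suc k) - 1)" by (simp add: algebra_simps)
      also have "\<dots> \<le> real (card I) * (real m / real (Suc k))"
        by (intro mult_left_mono) (simp_all add: field_simps)
      finally show ?thesis using z(2) by (simp add: C_def)
    qed
    finally have "(\<Prod>e\<in>I. real (g f e) / real n) \<le> C * (\<Prod>e\<in>I. X z e f)"
      using X0 by (simp add: mult_right_mono prod_nonneg less_imp_le)
    also have "\<dots> \<le> C * (\<Sum>z\<in>Z. \<Prod>e\<in>I. X z e f)"
      using z(1) finZ X0 by (intro mult_left_mono member_le_sum) (auto simp: C_def prod_nonneg less_imp_le)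
    finally show ?thesis .
  qed

  have sample: "(\<Sum>f\<in>PiE I (\<lambda>_. Q). \<Prod>e\<in>I. X z e f) \<le> real m ^ (k * n)" if z: "z \<in> Z" for z
  proof -
    define T where "T = {e\<in>I. \<exists>j<k. touch e (z j)}"
    have zV: "z j \<in> V" if "j < k" for j using z that by (auto simp: Z_def)
    have cardT: "card T \<le> k * n"
    proof -
      have "T = (\<Union>j\<in>{..<k}. {e\<in>I. touch e (z j)})" by (auto simp: T_def)
      then have "card T \<le> (\<Sum>j<k. card {e\<in>I. touch e (z j)})" by (simp add: card_UN_le)
      also have "\<dots> \<le> (\<Sum>j<k. n)" unfolding n_def by (intro sum_mono degree zV) simp
      finally show ?thesis by simp
    qed
    have TU: "T \<union> (I - T) = I" by (auto simp: T_def)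
    have "(\<Sum>f\<in>PiE I (\<lambda>_. Q). \<Prod>e\<in>I. X z e f) \<le> (\<Sum>f\<in>PiE I (\<lambda>_. Q). \<Prod>e\<in>I - T. X z e f)"
    proof (rule sum_mono)
      fix f
      have "(\<Prod>e\<in>I. X z e f) = (\<Prod>e\<in>I - T. X z e f) * (\<Prod>e\<in>T. X z e f)"
        using fin by (intro prod.subset_diff) (auto simp: T_def)
      also have "\<dots> \<le> (\<Prod>e\<in>I - T. X z e f) * 1"
        using X0 X1 by (intro mult_left_mono prod_le_1 prod_nonneg) (auto simp: less_imp_le)
      finally show "(\<Prod>e\<in>I. X z e f) \<le> (\<Prod>e\<in>I - T. X z e f)" by simp
    qed
    also have "\<dots> = (\<Sum>f\<in>PiE (T \<union> (I - T)) (\<lambda>_. Q). \<Prod>e\<in>I - T. X z e f)" by (simp only: TU)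
    also have "\<dots> \<le> real (card Q) ^ card T"
    proof (rule sum_predictions_le)
      fix e and f :: "'e \<Rightarrow> 'q" assume e: "e \<in> I - T"
      have "(\<Sum>a\<in>Q. cnt z e (f(e := a))) = (\<Sum>a\<in>Q. \<Sum>j<k. if good (f(e := a)) e (z j) then 1 else 0)"
        unfolding cnt_def by (intro sum.cong refl) (simp add: sum.If_cases Collect_conj_eq lessThan_def)
      also have "\<dots> = (\<Sum>j<k. \<Sum>a\<in>Q. if good (f(e := a)) e (z j) then 1 else 0)" by (rule sum.swap)
      also have "\<dots> \<le> (\<Sum>j<k. 1)"
      proof (rule sum_mono)
        fix j assume "j \<in> {..<k}"
        then have "card {a\<in>Q. good (f(e := a)) e (z j)} \<le> 1"
          using unique[of e "z j"] e zV[of j] fin by (auto simp: card_le_Suc0_iff_eq)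
        then show "(\<Sum>a\<in>Q. if good (f(e := a)) e (z j) then 1 else 0) \<le> (1::nat)"
          using fin by (simp add: sum.If_cases Int_def)
      qed
      finally have "(\<Sum>a\<in>Q. cnt z e (f(e := a))) \<le> k" by simp
      then have "(\<Sum>a\<in>Q. real (cnt z e (f(e := a)))) \<le> real k"
        by (metis of_nat_le_iff of_nat_sum)
      moreover have "(\<Sum>a\<in>Q. X z e (f(e := a))) = ((\<Sum>a\<in>Q. real (cnt z e (f(e := a)))) + real m) / (real k + real m)"
        by (simp add: X_def m_def sum.distrib flip: sum_divide_distrib)
      ultimately show "(\<Sum>a\<in>Q. X z e (f(e := a))) \<le> 1" using m by simp
    next
      fix e and f f' :: "'e \<Rightarrow> 'q" assume e: "e \<in> I - T" and ff': "f e = f' e" "\<And>e'. e' \<in> T \<Longrightarrow> f e' = f' e'"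
      have "good f e (z j) = good f' e (z j)" if "j < k" for j
        using e zV[OF that] ff' that by (intro local) (auto simp: T_def)
      then have "{j\<in>{..<k}. good f e (z j)} = {j\<in>{..<k}. good f' e (z j)}" by auto
      then show "X z e f = X z e f'" by (simp add: X_def cnt_def)
    qed (use fin X0 in \<open>auto simp: T_def less_imp_le\<close>)
    also have "\<dots> \<le> real m ^ (k * n)"
      using cardT m by (simp add: m_def power_increasing)
    finally show ?thesis .
  qed

  have "(\<Sum>f\<in>PiE I (\<lambda>_. Q). \<Prod>e\<in>I. real (g f e) / real n)
      \<le> (\<Sum>f\<in>PiE I (\<lambda>_. Q). C * (\<Sum>z\<in>Z. \<Prod>e\<in>I. X z e f))"
    by (intro sum_mono pointwise)
  also have "\<dots> = C * (\<Sum>z\<in>Z. \<Sum>f\<in>PiE I (\<lambda>_. Q). \<Prod>e\<in>I. X z e f)"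
    by (subst sum.swap) (simp add: sum_distrib_left)
  also have "\<dots> \<le> C * (\<Sum>z\<in>Z. real m ^ (k * n))"
    by (intro mult_left_mono sum_mono sample) (auto simp: C_def)
  also have "\<dots> = C * real n ^ k * real m ^ (k * n)"
    by (simp add: cardZ)
  finally show ?thesis by (simp add: C_def g_def m_def n_def)
qed

section \<open>Integer lattices of full rank\<close>

text \<open>Vectors are total functions that vanish from \<open>N\<close> on, so the spaces for
  growing \<open>N\<close> form a chain inside one type. Inductions on the last coordinate run along
  this chain.\<close>

definition int_vec :: "nat \<Rightarrow> (nat \<Rightarrow> int) set" where
  "int_vec N = {v. \<forall>k\<ge>N. v k = 0}"

lemma int_vec_SucD: "v \<in> int_vec (Suc n) \<Longrightarrow> v n = 0 \<Longrightarrow> v \<in> int_vec n"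
  unfolding int_vec_def mem_Collect_eq by (metis Suc_leI le_neq_implies_less)

locale int_lattice =
  fixes N :: nat and L :: "(nat \<Rightarrow> int) set"
  assumes subset: "L \<subseteq> int_vec N"
    and zero_mem: "(\<lambda>_. 0) \<in> L"
    and diff_mem: "u \<in> L \<Longrightarrow> v \<in> L \<Longrightarrow> (\<lambda>k. u k - v k) \<in> L"
begin

lemma add_mem: "u \<in> L \<Longrightarrow> v \<in> L \<Longrightarrow> (\<lambda>k. u k + v k) \<in> L"
  using diff_mem[of u "\<lambda>k. 0 - v k"] diff_mem[OF zero_mem, of v] by simp

lemma mult_mem:
  assumes u: "u \<in> L" shows "(\<lambda>k. c * u k) \<in> L"
proof (induction c rule: int_induct[where k=0])
  case (step1 i)
  then show ?case using add_mem[OF step1(2) u] by (simp add: algebra_simps)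
next
  case (step2 i)
  then show ?case using diff_mem[OF step2(2) u] by (simp add: algebra_simps)
qed (simp add: zero_mem)

lemma sum_mem: "finite I \<Longrightarrow> (\<And>i. i \<in> I \<Longrightarrow> f i \<in> L) \<Longrightarrow> (\<lambda>k. \<Sum>i\<in>I. f i k) \<in> L"
  by (induction I rule: finite_induct) (auto simp: zero_mem add_mem)

end

lemma int_ideal_generator:
  fixes J :: "int set"
  assumes diff: "\<And>x y. x \<in> J \<Longrightarrow> y \<in> J \<Longrightarrow> x - y \<in> J" and M: "M \<in> J" "M > 0"
  shows "\<exists>d\<in>J. d > 0 \<and> (\<forall>x\<in>J. d dvd x)"
proof -
  define n where "n = (LEAST n. int n \<in> J \<and> n > 0)"
  have "int (nat M) \<in> J \<and> nat M > 0" using M by simp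
  then have n: "int n \<in> J \<and> n > 0" unfolding n_def by (rule LeastI)
  have least: "n \<le> k" if "int k \<in> J" "k > 0" for k
    unfolding n_def using that by (intro Least_le) simp
  have J0: "0 \<in> J" using diff[OF M(1) M(1)] by simp
  have neg: "- x \<in> J" if "x \<in> J" for x using diff[OF J0 that] by simp
  have add: "x + y \<in> J" if "x \<in> J" "y \<in> J" for x y using diff[OF that(1) neg[OF that(2)]] by simp
  have mult: "c * int n \<in> J" for c
  proof (induction c rule: int_induct[where k=0])
    case (step1 i)
    then show ?case using add[of "i * int n" "int n"] n by (simp add: algebra_simps)
  next
    case (step2 i)
    then show ?case using diff[of "i * int n" "int n"] n by (simp add: algebra_simps)
  qed (simp add: J0)
  have "int n dvd x" if "x \<in> J" for x
  proof -
    have "x - x div int n * int n \<in> J" by (rule diff[OF that mult])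
    then have "x mod int n \<in> J" by (simp add: minus_div_mult_eq_mod)
    moreover have "x mod int n \<ge> 0" "x mod int n < int n" using n by simp_all
    ultimately show ?thesis
      using least[of "nat (x mod int n)"] by (cases "x mod int n = 0") (auto simp: dvd_eq_mod_eq_0)
  qed
  then show ?thesis using n by (intro bexI[of _ "int n"]) auto
qed

text \<open>For \<open>A \<subseteq> {..<N}\<close> this is the group of homomorphisms to Z/m from
  the quotient of Z^N by \<open>L\<close> and the unit vectors in \<open>A\<close>. A homomorphism
  is recorded by its residues on the unit vectors, so that cardinalities count
  homomorphisms.\<close>

definition annihilator :: "nat \<Rightarrow> (nat \<Rightarrow> int) set \<Rightarrow> int \<Rightarrow> nat set \<Rightarrow> (nat \<Rightarrow> int) set" where
  "annihilator N L m A =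
     {f \<in> PiE {..<N} (\<lambda>_. {0..<m}). (\<forall>v\<in>L. m dvd (\<Sum>k<N. f k * v k)) \<and> (\<forall>i\<in>A. f i = 0)}"

lemma finite_annihilator [simp]: "finite (annihilator N L m A)"
  unfolding annihilator_def by (rule finite_subset[of _ "PiE {..<N} (\<lambda>_. {0..<m})"]) (auto intro: finite_PiE)

text \<open>If \<open>c + x * d = M * t\<close> with \<open>0 \<le> x < M\<close>, then
  \<open>t\<close> determines \<open>x\<close>, and \<open>t\<close> lies in an interval of length
  \<open>d\<close> that starts at \<open>t0\<close>, the ceiling of c / M.\<close>

lemma card_linear_congruence_le:
  fixes M c :: int and d :: nat
  assumes "M > 0" "d > 0"
  shows "card {x\<in>{0..<M}. M dvd c + x * int d} \<le> d"
proof -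
  define t0 where "t0 = - ((- c) div M)"
  let ?g = "\<lambda>x. (c + x * int d) div M"
  have "inj_on ?g {x\<in>{0..<M}. M dvd c + x * int d}"
  proof (rule inj_onI, clarsimp)
    fix x y assume d: "M dvd c + x * int d" "M dvd c + y * int d"
      and e: "(c + x * int d) div M = (c + y * int d) div M"
    from d e have "c + x * int d = c + y * int d"
      by (metis dvd_div_mult_self)
    then show "x = y" using \<open>d > 0\<close> by simp
  qed
  moreover have "?g ` {x\<in>{0..<M}. M dvd c + x * int d} \<subseteq> {t0..<t0 + int d}"
  proof clarsimp
    fix x assume x: "0 \<le> x" "x < M" "M dvd c + x * int d"
    then obtain t where t: "c + x * int d = M * t" by (auto elim: dvdE)
    have "c \<le> M * t" using t x by (metis le_add_same_cancel1 mult_nonneg_nonneg of_nat_0_le_iff)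
    then have "(- t) * M \<le> - c" by (simp add: mult.commute)
    then have "- t \<le> (- c) div M"
      using zdiv_mono1[of "(- t) * M" "- c" M] \<open>M > 0\<close> nonzero_mult_div_cancel_right[of M "- t"] by linarith
    moreover have "(- c) div M < int d - t"
    proof -
      have "x * int d < M * int d" using x \<open>d > 0\<close> by simp
      then have "- c < (int d - t) * M" using t by (simp add: algebra_simps)
      moreover have "(- c) div M * M \<le> - c"
        using pos_mod_sign[OF \<open>M > 0\<close>, of "- c"] div_mult_mod_eq[of "- c" M] by linarith
      ultimately have "(- c) div M * M < (int d - t) * M" by linarith
      then show ?thesis using \<open>M > 0\<close> by simp
    qed
    ultimately show "t0 \<le> (c + x * int d) div M \<and> (c + x * int d) div M < t0 + int d"
      using t \<open>M > 0\<close> by (simp add: t0_def)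
  qed
  ultimately have "card {x\<in>{0..<M}. M dvd c + x * int d} \<le> card {t0..<t0 + int d}"
    by (intro card_inj_on_le) auto
  then show ?thesis by simp
qed

text \<open>Full rank is expressed by an exponent \<open>M\<close> of the quotient. Characters of
  the quotient can then be taken with values in Z/M.\<close>

locale full_int_lattice = int_lattice +
  fixes M :: int
  assumes M_pos: "M > 0"
    and full: "v \<in> int_vec N \<Longrightarrow> (\<lambda>k. M * v k) \<in> L"
begin

lemma unit_mult_mem: "i < N \<Longrightarrow> (\<lambda>k. if k = i then M else 0) \<in> L"
  using full[of "\<lambda>k. if k = i then 1 else 0"] by (auto simp: int_vec_def if_distrib cong: if_cong)

text \<open>Hermite normal form: \<open>d i\<close> generates the ideal of all entries at
  \<open>i\<close> of those vectors of \<open>L\<close> that vanish beyond \<open>i\<close>, and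
  \<open>b i\<close> attains it. The ideal is nonzero because it contains \<open>M\<close>.\<close>

lemma triangular_basis:
  obtains b :: "nat \<Rightarrow> nat \<Rightarrow> int" and d :: "nat \<Rightarrow> nat" where
    "\<And>i. i < N \<Longrightarrow> b i \<in> L" "\<And>i. i < N \<Longrightarrow> d i > 0" "\<And>i. i < N \<Longrightarrow> b i i = int (d i)"
    "\<And>i k. i < N \<Longrightarrow> i < k \<Longrightarrow> b i k = 0"
    "\<And>i v. i < N \<Longrightarrow> v \<in> L \<Longrightarrow> v \<in> int_vec (Suc i) \<Longrightarrow> int (d i) dvd v i"
proof -
  have "\<exists>b. b \<in> L \<and> b \<in> int_vec (Suc i) \<and> b i > 0 \<and> (\<forall>v\<in>L \<inter> int_vec (Suc i). b i dvd v i)"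
    if "i < N" for i
  proof -
    let ?J = "(\<lambda>v. v i) ` (L \<inter> int_vec (Suc i))"
    have "x - y \<in> ?J" if xy: "x \<in> ?J" "y \<in> ?J" for x y
    proof -
      obtain u v where uv: "u \<in> L \<inter> int_vec (Suc i)" "v \<in> L \<inter> int_vec (Suc i)" "x = u i" "y = v i"
        using xy by auto
      then show ?thesis
        by (intro image_eqI[of _ _ "\<lambda>k. u k - v k"]) (auto simp: diff_mem int_vec_def)
    qed
    moreover have "M \<in> ?J"
      using unit_mult_mem[OF that]
      by (intro image_eqI[of _ _ "\<lambda>k. if k = i then M else 0"]) (auto simp: int_vec_def)
    ultimately obtain d where "d \<in> ?J" "d > 0" "\<forall>x\<in>?J. d dvd x"
      using int_ideal_generator M_pos by metis
    then show ?thesis by auto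
  qed
  then obtain b where b: "\<And>i. i < N \<Longrightarrow> b i \<in> L \<and> b i \<in> int_vec (Suc i) \<and> b i i > 0 \<and>
      (\<forall>v\<in>L \<inter> int_vec (Suc i). b i i dvd v i)"
    by metis
  show ?thesis
  proof (rule that[of b "\<lambda>i. nat (b i i)"])
    fix i assume i: "i < N"
    note bi = b[OF i]
    show "b i \<in> L" "0 < nat (b i i)" "b i i = int (nat (b i i))" using bi by auto
    show "b i k = 0" if "i < k" for k using bi that by (auto simp: int_vec_def)
    show "int (nat (b i i)) dvd v i" if "v \<in> L" "v \<in> int_vec (Suc i)" for v
      using bi that by auto
  qed
qed

text \<open>\<open>D\<close> is the product of the pivots of a triangular basis. It divides the
  determinant because the \<open>c j\<close> are combinations of that basis. For the other two
  bounds the coordinates are treated one at a time, and \<open>d i\<close> bounds the choices at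
  coordinate \<open>i\<close>: the residues modulo \<open>d i\<close> for a representative, the
  solutions of a single linear congruence for a functional.\<close>

lemma det_bound_index:
  fixes c :: "nat \<Rightarrow> nat \<Rightarrow> int"
  assumes c: "\<And>j. j < N \<Longrightarrow> c j \<in> L"
    and gen: "\<And>v. v \<in> L \<Longrightarrow> \<exists>y. \<forall>k<N. v k = (\<Sum>j<N. y j * c j k)"
  obtains D :: nat and R :: "(nat \<Rightarrow> int) set" where
    "int D \<le> \<bar>Determinant.det (Matrix.mat N N (\<lambda>(k,j). c j k))\<bar>"
    "finite R" "card R \<le> D" "\<And>v. v \<in> int_vec N \<Longrightarrow> \<exists>r\<in>R. (\<lambda>k. v k - r k) \<in> L"
    "\<And>m. m > 0 \<Longrightarrow> card (annihilator N L m {}) \<le> D"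
proof -
  obtain b d where bL: "\<And>i. i < N \<Longrightarrow> b i \<in> L" and d0: "\<And>i. i < N \<Longrightarrow> d i > 0"
    and bd: "\<And>i. i < N \<Longrightarrow> b i i = int (d i)" and b0: "\<And>i k. i < N \<Longrightarrow> i < k \<Longrightarrow> b i k = 0"
    and dvd: "\<And>i v. i < N \<Longrightarrow> v \<in> L \<Longrightarrow> v \<in> int_vec (Suc i) \<Longrightarrow> int (d i) dvd v i"
    by (rule triangular_basis) blast
  define D where "D = (\<Prod>i<N. d i)"
  define R where "R = (\<lambda>g k. if k < N then g k else 0) ` PiE {..<N} (\<lambda>i. {0..<int (d i)})"

  have span: "\<exists>y. \<forall>k. v k = (\<Sum>i<n. y i * b i k)" if "n \<le> N" "v \<in> L" "v \<in> int_vec n" for n v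
    using that
  proof (induction n arbitrary: v)
    case 0
    then show ?case by (auto simp: int_vec_def)
  next
    case (Suc n)
    obtain q where q: "v n = int (d n) * q"
      using dvd[of n v] Suc.prems by (auto elim: dvdE)
    have "(\<lambda>k. v k - q * b n k) \<in> L"
      using diff_mem[OF Suc.prems(2) mult_mem[OF bL[of n]]] Suc.prems by simp
    moreover have "(\<lambda>k. v k - q * b n k) \<in> int_vec n"
      using Suc.prems q bd[of n] b0[of n] by - (rule int_vec_SucD, auto simp: int_vec_def)
    ultimately obtain y where y: "\<And>k. v k - q * b n k = (\<Sum>i<n. y i * b i k)"
      using Suc.IH[of "\<lambda>k. v k - q * b n k"] Suc.prems by auto
    have "v k = (\<Sum>i<Suc n. (y(n := q)) i * b i k)" for k
      using y[of k] by simp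
    then show ?case by blast
  qed

  have det: "int D \<le> \<bar>Determinant.det (Matrix.mat N N (\<lambda>(k,j). c j k))\<bar>"
  proof -
    let ?C = "Matrix.mat N N (\<lambda>(k,j). c j k)"
    have "\<exists>y. \<forall>k. c j k = (\<Sum>i<N. y i * b i k)" if "j < N" for j
      using span[of N "c j"] c[OF that] subset by auto
    then obtain y where y: "\<And>j k. j < N \<Longrightarrow> c j k = (\<Sum>i<N. y j i * b i k)" by metis
    let ?B = "Matrix.mat N N (\<lambda>(k,i). b i k)" and ?Y = "Matrix.mat N N (\<lambda>(i,j). y j i)"
    have "?C = ?B * ?Y"
      by (rule eq_matI) (auto simp: y scalar_prod_def atLeast0LessThan mult.commute intro!: sum.cong)
    then have "Determinant.det ?C = Determinant.det ?B * Determinant.det ?Y"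
      by (simp add: det_mult[of _ N])
    also have "Determinant.det ?B = int D"
      by (subst det_upper_triangular[of _ N])
         (auto simp: b0 bd prod_list_diag_prod atLeast0LessThan D_def upper_triangular_def intro!: prod.cong)
    finally have dD: "int D dvd Determinant.det ?C" by simp
    \<comment> \<open>A divisor bounds the determinant only if the latter is nonzero. This holds
      because the \<open>c j\<close> generate \<open>M\<close> times each unit vector, so the matrix
      has a right inverse up to the factor \<open>M\<close>.\<close>
    have "\<exists>x. \<forall>k<N. (if k = i then M else 0) = (\<Sum>j<N. x j * c j k)" if "i < N" for i
      using gen[OF unit_mult_mem[OF that]] .
    then obtain x where "\<And>i k. i < N \<Longrightarrow> k < N \<Longrightarrow> (if k = i then M else 0) = (\<Sum>j<N. x i j * c j k)"
      by metis
    then have x: "(\<Sum>j<N. c j k * x i j) = (if k = i then M else 0)" if "i < N" "k < N" for i k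
      using that by (simp add: mult.commute)
    let ?X = "Matrix.mat N N (\<lambda>(j,i). x i j)"
    have "M \<cdot>\<^sub>m 1\<^sub>m N = ?C * ?X"
      by (rule eq_matI) (auto simp: x scalar_prod_def atLeast0LessThan)
    then have "Determinant.det (M \<cdot>\<^sub>m 1\<^sub>m N) = Determinant.det ?C * Determinant.det ?X"
      by (simp add: det_mult[of _ N])
    then have "Determinant.det ?C \<noteq> 0"
      using M_pos by (auto simp: det_smult)
    with dD show ?thesis
      by (simp add: zdvd_imp_le dvd_abs_iff flip: zero_less_abs_iff)
  qed

  have reps: "\<exists>r. (\<forall>i<n. 0 \<le> r i \<and> r i < int (d i)) \<and> r \<in> int_vec n \<and> (\<lambda>k. v k - r k) \<in> L"
    if "n \<le> N" "v \<in> int_vec n" for n v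
    using that
  proof (induction n arbitrary: v)
    case 0
    then have "v = (\<lambda>_. 0)" by (auto simp: int_vec_def)
    then show ?case using zero_mem by (auto simp: int_vec_def)
  next
    case (Suc n)
    define s where "s = v n mod int (d n)"
    define q where "q = v n div int (d n)"
    have vn: "v n = q * int (d n) + s" by (simp add: s_def q_def)
    let ?w = "\<lambda>k. v k - q * b n k - (if k = n then s else 0)"
    have "?w \<in> int_vec n"
      using Suc.prems vn bd[of n] b0[of n] by - (rule int_vec_SucD, auto simp: int_vec_def)
    then obtain r where r: "\<forall>i<n. 0 \<le> r i \<and> r i < int (d i)" "r \<in> int_vec n" "(\<lambda>k. ?w k - r k) \<in> L"
      using Suc.IH[of ?w] Suc.prems by auto
    have rn: "r n = 0" using r(2) by (simp add: int_vec_def)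
    have "(\<lambda>k. (?w k - r k) + q * b n k) \<in> L"
      using Suc.prems by (intro add_mem r(3) mult_mem bL) simp
    also have "(\<lambda>k. (?w k - r k) + q * b n k) = (\<lambda>k. v k - (r(n := s)) k)"
      using rn by auto
    finally have "(\<lambda>k. v k - (r(n := s)) k) \<in> L" .
    moreover have "\<forall>i<Suc n. 0 \<le> (r(n := s)) i \<and> (r(n := s)) i < int (d i)"
      using r(1) d0[of n] Suc.prems by (auto simp: s_def less_Suc_eq)
    moreover have "r(n := s) \<in> int_vec (Suc n)" using r(2) by (auto simp: int_vec_def)
    ultimately show ?case by blast
  qed
  have R: "\<exists>r\<in>R. (\<lambda>k. v k - r k) \<in> L" if v: "v \<in> int_vec N" for v
  proof -
    obtain r where r: "\<forall>i<N. 0 \<le> r i \<and> r i < int (d i)" "r \<in> int_vec N" "(\<lambda>k. v k - r k) \<in> L"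
      using reps[OF order_refl v] by blast
    have "r \<in> R" unfolding R_def
      by (rule image_eqI[of _ _ "restrict r {..<N}"]) (use r in \<open>auto simp: int_vec_def\<close>)
    then show ?thesis using r by blast
  qed
  have finR: "finite R" unfolding R_def by (intro finite_imageI finite_PiE) auto
  have cardR: "card R \<le> D"
  proof -
    have "card R \<le> card (PiE {..<N} (\<lambda>i. {0..<int (d i)}))"
      unfolding R_def by (intro card_image_le finite_PiE) auto
    then show ?thesis by (simp add: card_PiE D_def)
  qed

  have ann: "card (annihilator N L m {}) \<le> D" if m: "m > 0" for m
  proof -
    \<comment> \<open>Since \<open>b i\<close> vanishes beyond \<open>i\<close>, its condition
      involves only the values of \<open>f\<close> up to \<open>i\<close>. Hence these sets can be
      counted by extending functionals one coordinate at a time.\<close>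
    define X where "X n = {f \<in> PiE {..<n} (\<lambda>_. {0..<m}). \<forall>i<n. m dvd (\<Sum>k\<le>i. f k * b i k)}" for n
    have finX: "finite (X n)" for n
      unfolding X_def by (rule finite_subset[of _ "PiE {..<n} (\<lambda>_. {0..<m})"]) (auto intro: finite_PiE)
    have "card (X n) \<le> (\<Prod>i<n. d i)" if "n \<le> N" for n
      using that
    proof (induction n)
      case 0
      have "X 0 \<subseteq> {\<lambda>_. undefined}" by (auto simp: X_def)
      then show ?case using card_mono[of "{\<lambda>_. undefined}" "X 0"] by simp
    next
      case (Suc n)
      define Y where "Y g = {x\<in>{0..<m}. m dvd (\<Sum>k<n. g k * b n k) + x * int (d n)}" for g
      have finY: "finite (Y g)" for g
        unfolding Y_def by (rule finite_subset[of _ "{0..<m}"]) auto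
      have "X (Suc n) \<subseteq> (\<lambda>(g,x). g(n := x)) ` (SIGMA g:X n. Y g)"
      proof
        fix f assume f: "f \<in> X (Suc n)"
        then have "f \<in> PiE (insert n {..<n}) (\<lambda>_. {0..<m})" by (auto simp: X_def lessThan_Suc)
        then obtain x g where xg: "f = g(n := x)" "x \<in> {0..<m}" "g \<in> PiE {..<n} (\<lambda>_. {0..<m})"
          unfolding PiE_insert_eq by auto
        have cong: "(\<Sum>k\<le>i. f k * b i k) = (\<Sum>k\<le>i. g k * b i k)" if "i < n" for i
          using that xg(1) by (intro sum.cong) auto
        have "(\<Sum>k\<le>n. f k * b n k) = (\<Sum>k<n. g k * b n k) + x * int (d n)"
          using xg(1) bd[of n] Suc.prems by (simp flip: lessThan_Suc_atMost)
        moreover have "m dvd (\<Sum>k\<le>n. f k * b n k)" using f by (auto simp: X_def)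
        ultimately have "x \<in> Y g" using xg by (auto simp: Y_def)
        moreover have "g \<in> X n"
        proof -
          have "m dvd (\<Sum>k\<le>i. g k * b i k)" if "i < n" for i
          proof -
            have "m dvd (\<Sum>k\<le>i. f k * b i k)" using f that by (simp add: X_def)
            then show ?thesis by (simp only: cong[OF that])
          qed
          then show ?thesis using xg by (auto simp: X_def)
        qed
        ultimately show "f \<in> (\<lambda>(g,x). g(n := x)) ` (SIGMA g:X n. Y g)"
          using xg by (intro image_eqI[of _ _ "(g, x)"]) auto
      qed
      then have "card (X (Suc n)) \<le> card ((\<lambda>(g,x). g(n := x)) ` (SIGMA g:X n. Y g))"
        by (intro card_mono finite_imageI finite_SigmaI finX finY)
      also have "\<dots> \<le> card (SIGMA g:X n. Y g)"
        by (intro card_image_le finite_SigmaI finX finY)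
      also have "\<dots> = (\<Sum>g\<in>X n. card (Y g))"
        by (simp add: card_SigmaI finX finY)
      also have "\<dots> \<le> (\<Sum>g\<in>X n. d n)"
        unfolding Y_def using d0[of n] Suc.prems m by (intro sum_mono card_linear_congruence_le) auto
      also have "\<dots> \<le> (\<Prod>i<Suc n. d i)"
        using Suc by simp
      finally show ?case .
    qed
    moreover have "annihilator N L m {} \<subseteq> X N"
    proof
      fix f assume f: "f \<in> annihilator N L m {}"
      have "m dvd (\<Sum>k\<le>i. f k * b i k)" if "i < N" for i
      proof -
        have "(\<Sum>k\<le>i. f k * b i k) = (\<Sum>k<N. f k * b i k)"
          using that b0[of i] by (intro sum.mono_neutral_left) auto
        then show ?thesis using f bL[OF that] by (auto simp: annihilator_def)
      qed
      then show "f \<in> X N" using f by (auto simp: annihilator_def X_def)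
    qed
    ultimately show ?thesis
      using card_mono[OF finX, of "annihilator N L m {}" N] by (force simp: D_def)
  qed
  show ?thesis by (rule that[OF det finR cardR R ann])
qed

end

text \<open>Induction on the last coordinate. If some \<open>b\<close> in \<open>L\<close> ends in
  1, every vector is congruent modulo \<open>L\<close> to one in the smaller space, and a character
  found there extends by the value that makes it kill \<open>b\<close>. Otherwise the last entries
  of \<open>L\<close> are multiples of some \<open>d > 1\<close> dividing \<open>M\<close>, and M /
  d times the last coordinate is a character.\<close>

lemma proper_lattice_has_character:
  assumes "full_int_lattice N L M" "L \<noteq> int_vec N"
  shows "\<exists>f. (\<exists>i<N. \<not> M dvd f i) \<and> (\<forall>v\<in>L. M dvd (\<Sum>k<N. f k * v k))"
  using assms
proof (induction N arbitrary: L)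
  case 0
  then interpret full_int_lattice 0 L M by simp
  have "int_vec 0 = {\<lambda>_. 0}" by (auto simp: int_vec_def)
  then show ?case using 0 zero_mem subset by auto
next
  case (Suc N)
  then interpret full_int_lattice "Suc N" L M by simp
  show ?case
  proof (cases "\<exists>b\<in>L. b N = 1")
    case True
    then obtain b where b: "b \<in> L" "b N = 1" by blast
    have shift: "(\<lambda>k. v k - v N * b k) \<in> int_vec N" if "v \<in> int_vec (Suc N)" for v
      using that b subset by - (rule int_vec_SucD, auto simp: int_vec_def)
    let ?L = "L \<inter> int_vec N"
    have full': "full_int_lattice N ?L M"
    proof
      fix v assume "v \<in> int_vec N"
      then show "(\<lambda>k. M * v k) \<in> ?L" using full[of v] by (auto simp: int_vec_def)
    qed (auto simp: zero_mem diff_mem M_pos int_vec_def)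
    moreover have "?L \<noteq> int_vec N"
    proof
      assume L: "?L = int_vec N"
      have "v \<in> L" if "v \<in> int_vec (Suc N)" for v
      proof -
        have "(\<lambda>k. v k - v N * b k) \<in> L" using shift[OF that] L by auto
        from add_mem[OF this mult_mem[OF b(1), of "v N"]] show ?thesis by simp
      qed
      then show False using Suc.prems subset by auto
    qed
    ultimately obtain f i where f: "i < N" "\<not> M dvd f i" "\<And>v. v \<in> ?L \<Longrightarrow> M dvd (\<Sum>k<N. f k * v k)"
      using Suc.IH by blast
    define g where "g = f(N := - (\<Sum>k<N. f k * b k))"
    have "M dvd (\<Sum>k<Suc N. g k * v k)" if "v \<in> L" for v
    proof -
      have "(\<Sum>k<Suc N. g k * v k) = (\<Sum>k<N. f k * (v k - v N * b k))"
        by (simp add: g_def algebra_simps sum_subtractf sum_distrib_left)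
      moreover have "(\<lambda>k. v k - v N * b k) \<in> ?L"
        using diff_mem[OF that mult_mem[OF b(1), of "v N"]] shift that subset by auto
      ultimately show ?thesis using f(3) by metis
    qed
    moreover have "i < Suc N \<and> \<not> M dvd g i" using f by (simp add: g_def)
    ultimately show ?thesis by blast
  next
    case False
    let ?J = "(\<lambda>v. v N) ` L"
    have "x - y \<in> ?J" if xy: "x \<in> ?J" "y \<in> ?J" for x y
    proof -
      obtain u v where "u \<in> L" "v \<in> L" "x = u N" "y = v N" using xy by auto
      then show ?thesis by (intro image_eqI[of _ _ "\<lambda>k. u k - v k"]) (auto simp: diff_mem)
    qed
    moreover have MJ: "M \<in> ?J"
      using unit_mult_mem[of N] by (intro image_eqI[of _ _ "\<lambda>k. if k = N then M else 0"]) auto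
    ultimately obtain d where d: "d \<in> ?J" "d > 0" "\<forall>x\<in>?J. d dvd x"
      using int_ideal_generator M_pos by metis
    have "d \<noteq> 1" using False d(1) by auto
    obtain q where q: "M = d * q" using d(3) MJ by (auto elim: dvdE)
    have "q > 0" using q M_pos d(2) by (simp add: zero_less_mult_iff)
    have "\<not> M dvd q"
      using zdvd_imp_le[of M q] q \<open>q > 0\<close> \<open>d \<noteq> 1\<close> d(2) by auto
    moreover have "M dvd (\<Sum>k<Suc N. (if k = N then q else 0) * v k)" if "v \<in> L" for v
    proof -
      have "(\<Sum>k<Suc N. (if k = N then q else 0) * v k) = q * v N"
        by (simp add: if_distrib[of "\<lambda>x. x * _"] cong: if_cong)
      moreover have "d dvd v N" using d(3) that by blast
      ultimately show ?thesis using q by (simp add: mult.commute mult_dvd_mono)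
    qed
    ultimately show ?thesis
      by (intro exI[of _ "\<lambda>k. if k = N then q else 0"]) auto
  qed
qed

section \<open>Greedy choice of generators\<close>

text \<open>Every added index costs a factor \<open>c \<ge> 2\<close> of a potential that stays
  positive, so the process must stop, and it can stop only where \<open>Q\<close> holds. The
  potential will be the size of an annihilator.\<close>

lemma greedy_potential:
  fixes \<phi> :: "nat set \<Rightarrow> nat"
  assumes pos: "\<And>A. \<phi> A > 0" and c: "c \<ge> 2"
    and step: "\<And>A. A0 \<subseteq> A \<Longrightarrow> A \<subseteq> {..<N} \<Longrightarrow> \<not> Q A \<Longrightarrow>
      \<exists>i<N. i \<notin> A \<and> c * \<phi> (insert i A) \<le> \<phi> A"
    and A0: "A0 \<subseteq> {..<N}"
  shows "\<exists>A. A0 \<subseteq> A \<and> A \<subseteq> {..<N} \<and> Q A \<and> c ^ card (A - A0) \<le> \<phi> A0"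
proof -
  have "\<exists>A. A1 \<subseteq> A \<and> A \<subseteq> {..<N} \<and> Q A \<and> c ^ card (A - A1) * \<phi> A \<le> \<phi> A1"
    if "A0 \<subseteq> A1" "A1 \<subseteq> {..<N}" for A1
    using that
  proof (induction "\<phi> A1" arbitrary: A1 rule: less_induct)
    case less
    show ?case
    proof (cases "Q A1")
      case True
      then show ?thesis using less.prems by (intro exI[of _ A1]) auto
    next
      case False
      then obtain i where i: "i < N" "i \<notin> A1" "c * \<phi> (insert i A1) \<le> \<phi> A1"
        using step less.prems by blast
      have "2 * \<phi> (insert i A1) \<le> c * \<phi> (insert i A1)" using c by (intro mult_right_mono) auto
      then have "\<phi> (insert i A1) < \<phi> A1" using i(3) pos[of "insert i A1"] by linarith
      then obtain A where A: "insert i A1 \<subseteq> A" "A \<subseteq> {..<N}" "Q A"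
          "c ^ card (A - insert i A1) * \<phi> A \<le> \<phi> (insert i A1)"
        using less.hyps[of "insert i A1"] less.prems i(1) by (metis insert_subset lessThan_iff subset_insertI2)
      have fin: "finite A" using A(2) finite_subset by blast
      have eq: "A - A1 = insert i (A - insert i A1)" using A(1) i(2) by auto
      have "card (A - A1) = Suc (card (A - insert i A1))"
        unfolding eq by (rule card_insert_disjoint) (use fin in auto)
      then have "c ^ card (A - A1) * \<phi> A = c * (c ^ card (A - insert i A1) * \<phi> A)"
        by (simp only: power_Suc mult.assoc)
      also have "\<dots> \<le> c * \<phi> (insert i A1)" using A(4) by (rule mult_left_mono) simp
      also have "\<dots> \<le> \<phi> A1" by (rule i(3))
      finally show ?thesis using A by (intro exI[of _ A]) auto
    qed
  qed
  from this[OF order_refl A0] obtain A where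
    A: "A0 \<subseteq> A" "A \<subseteq> {..<N}" "Q A" "c ^ card (A - A0) * \<phi> A \<le> \<phi> A0" by blast
  have "c ^ card (A - A0) * 1 \<le> c ^ card (A - A0) * \<phi> A"
    using pos[of A] by (intro mult_left_mono) auto
  then have "c ^ card (A - A0) \<le> \<phi> A0" using A(4) unfolding mult_1_right by (rule order_trans)
  then show ?thesis using A by blast
qed

text \<open>The translates of the smaller annihilator by \<open>j * f\<close> with \<open>j < c\<close> are disjoint.\<close>

lemma card_annihilator_insert:
  assumes m: "m > 0" and f: "f \<in> annihilator N L m A" and i: "i < N"
    and ndvd: "\<And>r. 1 \<le> r \<Longrightarrow> r < int c \<Longrightarrow> \<not> m dvd r * f i"
  shows "c * card (annihilator N L m (insert i A)) \<le> card (annihilator N L m A)"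
proof -
  let ?h = "\<lambda>(j,g). \<lambda>k\<in>{..<N}. (g k + int j * f k) mod m"
  let ?X = "annihilator N L m (insert i A)"
  have "inj_on ?h ({..<c} \<times> ?X)"
  proof (rule inj_onI)
    fix p q assume pq: "p \<in> {..<c} \<times> ?X" "q \<in> {..<c} \<times> ?X" "?h p = ?h q"
    obtain j g j' g' where p: "p = (j, g)" and q: "q = (j', g')" by (metis surj_pair)
    have j: "j < c" "j' < c" and g: "g \<in> ?X" "g' \<in> ?X" using pq by (auto simp: p q)
    have eq: "(\<lambda>k\<in>{..<N}. (g k + int j * f k) mod m) = (\<lambda>k\<in>{..<N}. (g' k + int j' * f k) mod m)"
      using pq(3) by (simp only: p q prod.case)
    have eqk: "(g k + int j * f k) mod m = (g' k + int j' * f k) mod m" if "k < N" for k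
      using fun_cong[OF eq, of k] that by simp
    have "g i = 0" "g' i = 0" using g by (auto simp: annihilator_def)
    then have "(int j * f i) mod m = (int j' * f i) mod m" using eqk[OF i] by simp
    then have d: "m dvd (int j - int j') * f i" "m dvd (int j' - int j) * f i"
      by (simp_all add: left_diff_distrib flip: mod_eq_dvd_iff)
    have "j = j'"
    proof (rule ccontr)
      assume "j \<noteq> j'"
      then consider "1 \<le> int j - int j'" | "1 \<le> int j' - int j" by linarith
      then show False using d ndvd j by cases auto
    qed
    moreover have "g k = g' k" for k
    proof (cases "k < N")
      case True
      have "m dvd g k - g' k"
        using eqk[OF True] \<open>j = j'\<close> by (simp add: mod_eq_dvd_iff)
      then have "g k mod m = g' k mod m" by (simp add: mod_eq_dvd_iff)
      moreover have "g k \<in> {0..<m}" "g' k \<in> {0..<m}" using g True by (auto simp: annihilator_def PiE_def Pi_def)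
      ultimately show ?thesis by simp
    next
      case False
      have "g k = undefined" "g' k = undefined" using g False by (auto simp: annihilator_def PiE_def extensional_def)
      then show ?thesis by simp
    qed
    ultimately show "p = q" by (auto simp: p q)
  qed
  moreover have "?h ` ({..<c} \<times> ?X) \<subseteq> annihilator N L m A"
  proof (rule image_subsetI)
    fix p assume p_mem: "p \<in> {..<c} \<times> ?X"
    obtain j g where p: "p = (j, g)" by (metis surj_pair)
    have g: "g \<in> ?X" using p_mem by (simp add: p)
    have "m dvd (\<Sum>k<N. (\<lambda>k\<in>{..<N}. (g k + int j * f k) mod m) k * v k)" if v: "v \<in> L" for v
    proof -
      have "(\<Sum>k<N. (\<lambda>k\<in>{..<N}. (g k + int j * f k) mod m) k * v k) mod m
          = (\<Sum>k<N. ((g k + int j * f k) mod m * v k) mod m) mod m"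
        by (simp add: mod_sum_eq)
      also have "\<dots> = (\<Sum>k<N. (g k + int j * f k) * v k) mod m"
        by (simp only: mod_mult_left_eq mod_sum_eq)
      also have "(\<Sum>k<N. (g k + int j * f k) * v k) = (\<Sum>k<N. g k * v k) + int j * (\<Sum>k<N. f k * v k)"
        by (simp add: algebra_simps sum.distrib sum_distrib_left)
      also have "m dvd \<dots>"
        using g f v by (intro dvd_add dvd_mult) (auto simp: annihilator_def)
      ultimately show ?thesis by (simp add: dvd_eq_mod_eq_0)
    qed
    moreover have "(\<lambda>k\<in>{..<N}. (g k + int j * f k) mod m) k = 0" if "k \<in> A" for k
      using g f that m by (cases "k < N") (auto simp: annihilator_def PiE_def extensional_def)
    ultimately have "(\<lambda>k\<in>{..<N}. (g k + int j * f k) mod m) \<in> annihilator N L m A"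
      using m by (auto simp: annihilator_def)
    then show "?h p \<in> annihilator N L m A" by (simp only: p prod.case)
  qed
  ultimately have "card ({..<c} \<times> ?X) \<le> card (annihilator N L m A)"
    by (intro card_inj_on_le) auto
  then show ?thesis by (simp add: card_cartesian_product)
qed

lemma card_annihilator_pos: "m > 0 \<Longrightarrow> A \<subseteq> {..<N} \<Longrightarrow> card (annihilator N L m A) > 0"
proof -
  assume "m > 0" "A \<subseteq> {..<N}"
  then have "(\<lambda>k\<in>{..<N}. 0) \<in> annihilator N L m A"
    by (auto simp: annihilator_def)
  then show ?thesis by (auto simp: card_gt_0_iff)
qed

definition trivial_annihilator :: "nat \<Rightarrow> (nat \<Rightarrow> int) set \<Rightarrow> int \<Rightarrow> nat set \<Rightarrow> bool" where
  "trivial_annihilator N L m A \<longleftrightarrow> (\<forall>f\<in>annihilator N L m A. \<forall>i<N. f i = 0)"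

lemma annihilator_nonneg_less: "f \<in> annihilator N L m A \<Longrightarrow> i < N \<Longrightarrow> 0 \<le> f i \<and> f i < m"
  by (auto simp: annihilator_def PiE_def Pi_def)

text \<open>The unit vectors in \<open>A\<close> leave no functional of order dividing \<open>P!\<close>. Every functional
  that survives \<open>A\<close> thus has order greater than \<open>P\<close>, so each unit vector in \<open>B\<close> divides the
  size of the annihilator by at least \<open>P + 1\<close>.\<close>

lemma (in full_int_lattice) few_generators:
  fixes P D :: nat
  assumes P: "P > 0" and D: "\<And>m. m > 0 \<Longrightarrow> card (annihilator N L m {}) \<le> D"
  obtains A B where "A \<subseteq> {..<N}" "B \<subseteq> {..<N}"
    "2 ^ card A \<le> card (annihilator N L (fact P) {})" "(P + 1) ^ card B \<le> D"
    "\<And>v. v \<in> int_vec N \<Longrightarrow> \<exists>u\<in>L. \<forall>k<N. k \<notin> A \<union> B \<longrightarrow> v k = u k"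
proof -
  define m :: int where "m = fact P"
  have m: "m > 0" by (simp add: m_def)
  \<comment> \<open>Multiplication by \<open>M\<close> embeds the functionals modulo
    \<open>m\<close> into those modulo \<open>K\<close>. Its image consists of the functionals
    divisible by \<open>M\<close>, which are those of order dividing \<open>m\<close>.\<close>
  define K where "K = M * m"
  have K: "K > 0" using M_pos m by (simp add: K_def)
  \<comment> \<open>The intersection keeps the potential positive on every set, as the greedy lemma
    demands; at an index outside \<open>{..<N}\<close> a functional takes the default value, which
    need not be 0.\<close>
  define \<phi> where "\<phi> m A = card (annihilator N L m (A \<inter> {..<N}))" for m A
  have \<phi>: "\<phi> m A = card (annihilator N L m A)" if "A \<subseteq> {..<N}" for m A
    using that by (simp add: \<phi>_def Int_absorb2)
  have "\<exists>A. {} \<subseteq> A \<and> A \<subseteq> {..<N} \<and> trivial_annihilator N L m A \<and> 2 ^ card (A - {}) \<le> \<phi> m {}"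
  proof (rule greedy_potential[where \<phi>="\<phi> m" and Q="trivial_annihilator N L m" and c=2])
    show "\<phi> m A > 0" for A unfolding \<phi>_def by (intro card_annihilator_pos m) auto
    fix A assume A: "A \<subseteq> {..<N}" "\<not> trivial_annihilator N L m A"
    then obtain f i where f: "f \<in> annihilator N L m A" "i < N" "f i \<noteq> 0"
      by (auto simp: trivial_annihilator_def)
    have "\<not> m dvd f i" using annihilator_nonneg_less[OF f(1,2)] f(3) zdvd_imp_le[of m "f i"] by auto
    then have "\<not> m dvd r * f i" if "1 \<le> r" "r < int 2" for r
      using that by (cases "r = 1") auto
    then have "2 * card (annihilator N L m (insert i A)) \<le> card (annihilator N L m A)"
      by (rule card_annihilator_insert[OF m f(1,2)])
    moreover have "i \<notin> A" using f by (auto simp: annihilator_def)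
    ultimately show "\<exists>i<N. i \<notin> A \<and> 2 * \<phi> m (insert i A) \<le> \<phi> m A"
      using f(2) A(1) by (intro exI[of _ i]) (simp add: \<phi>)
  qed auto
  then obtain A where A: "A \<subseteq> {..<N}" "trivial_annihilator N L m A" "2 ^ card A \<le> \<phi> m {}" by auto

  have "\<exists>B. A \<subseteq> B \<and> B \<subseteq> {..<N} \<and> trivial_annihilator N L K B \<and> (P + 1) ^ card (B - A) \<le> \<phi> K A"
  proof (rule greedy_potential[where \<phi>="\<phi> K" and Q="trivial_annihilator N L K" and c="P + 1"])
    show "\<phi> K A > 0" for A unfolding \<phi>_def by (intro card_annihilator_pos K) auto
    show "2 \<le> P + 1" using P by simp
    fix B assume B: "A \<subseteq> B" "B \<subseteq> {..<N}" "\<not> trivial_annihilator N L K B"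
    then obtain f i where f: "f \<in> annihilator N L K B" "i < N" "f i \<noteq> 0"
      by (auto simp: trivial_annihilator_def)
    \<comment> \<open>Otherwise \<open>f\<close> divided by \<open>M\<close> would be a nonzero
      functional modulo \<open>m\<close> that vanishes on \<open>A\<close>, against the choice of
      \<open>A\<close>.\<close>
    have "\<exists>k<N. \<not> M dvd f k"
    proof (rule ccontr)
      assume "\<not> (\<exists>k<N. \<not> M dvd f k)"
      then have Mf: "f k = M * (f k div M)" if "k < N" for k using that by simp
      define g where "g = (\<lambda>k\<in>{..<N}. f k div M)"
      have "g \<in> annihilator N L m A"
      proof -
        have "g k \<in> {0..<m}" if "k < N" for k
        proof -
          have "0 \<le> f k" "f k < M * m"
            using annihilator_nonneg_less[OF f(1) that] by (auto simp: K_def)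
          then have "0 \<le> M * (f k div M)" "M * (f k div M) < M * m" using Mf[OF that] by auto
          then show ?thesis using M_pos that by (simp add: g_def zero_le_mult_iff)
        qed
        moreover have "m dvd (\<Sum>k<N. g k * v k)" if "v \<in> L" for v
        proof -
          have "(\<Sum>k<N. f k * v k) = (\<Sum>k<N. M * (g k * v k))"
            using Mf by (intro sum.cong) (auto simp: g_def)
          then have "M * m dvd M * (\<Sum>k<N. g k * v k)"
            using f(1) that by (auto simp: annihilator_def K_def sum_distrib_left)
          then show ?thesis using M_pos by simp
        qed
        moreover have "g k = 0" if "k \<in> A" for k
        proof -
          have "f k = 0" "k < N" using that f(1) B A(1) by (auto simp: annihilator_def)
          then show ?thesis by (simp add: g_def)
        qed
        ultimately show ?thesis by (auto simp: annihilator_def g_def)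
      qed
      then have "g i = 0" using A(2) f(2) by (auto simp: trivial_annihilator_def)
      then show False using Mf[OF f(2)] f(2,3) by (simp add: g_def)
    qed
    then obtain k where k: "k < N" "\<not> M dvd f k" by blast
    \<comment> \<open>Any such \<open>r\<close> is at most \<open>P\<close> and divides
      \<open>m\<close>. If \<open>M * m\<close> divided \<open>r * f k\<close>, then multiplying by
      \<open>m / r\<close> would show that it divides \<open>m * f k\<close>, hence that
      \<open>M\<close> divides \<open>f k\<close>.\<close>
    have "\<not> K dvd r * f k" if "1 \<le> r" "r < int (P + 1)" for r
    proof
      assume d: "K dvd r * f k"
      have "nat r dvd fact P" using that by (intro dvd_fact) auto
      then have "int (nat r) dvd int (fact P)" by (simp only: int_dvd_int_iff)
      then have "r dvd m" using that by (simp add: m_def)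
      then obtain t where t: "m = r * t" by (auto elim: dvdE)
      have "M * m dvd t * (r * f k)" using d by (simp add: K_def)
      then have "m * M dvd m * f k" by (simp add: t mult_ac)
      then show False using k m by simp
    qed
    then have "(P + 1) * card (annihilator N L K (insert k B)) \<le> card (annihilator N L K B)"
      by (rule card_annihilator_insert[OF K f(1) k(1)])
    moreover have "k \<notin> B" using f(1) k by (auto simp: annihilator_def)
    ultimately show "\<exists>i<N. i \<notin> B \<and> (P + 1) * \<phi> K (insert i B) \<le> \<phi> K B"
      using k(1) B(2) by (intro exI[of _ k]) (simp add: \<phi>)
  qed (rule A(1))
  then obtain B where B: "A \<subseteq> B" "B \<subseteq> {..<N}" "trivial_annihilator N L K B" "(P + 1) ^ card (B - A) \<le> \<phi> K A"
    by blast
  have "\<phi> K A \<le> \<phi> K {}"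
    unfolding \<phi>_def by (intro card_mono finite_annihilator) (auto simp: annihilator_def)
  also have "\<dots> \<le> D" using D[OF K] by (simp add: \<phi>_def)
  finally have BD: "(P + 1) ^ card (B - A) \<le> D" using B(4) by simp

  \<comment> \<open>This is \<open>L\<close> plus the span of the unit vectors in \<open>B\<close>.
    If it were proper, a character of the quotient, reduced modulo \<open>K\<close>, would be a
    nonzero functional that vanishes on \<open>B\<close>.\<close>
  define L' where "L' = {v\<in>int_vec N. \<exists>u\<in>L. \<forall>k<N. k \<notin> B \<longrightarrow> v k = u k}"
  have LL': "L \<subseteq> L'" using subset by (auto simp: L'_def)
  have "full_int_lattice N L' K"
  proof
    show "(\<lambda>k. u k - v k) \<in> L'" if uv: "u \<in> L'" "v \<in> L'" for u v
    proof -
      obtain u' v' where *: "u' \<in> L" "v' \<in> L" "\<And>k. k < N \<Longrightarrow> k \<notin> B \<Longrightarrow> u k = u' k" "\<And>k. k < N \<Longrightarrow> k \<notin> B \<Longrightarrow> v k = v' k"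
        using uv by (auto simp: L'_def)
      show ?thesis
        unfolding L'_def using uv * diff_mem[OF *(1,2)]
        by (auto simp: int_vec_def L'_def intro!: bexI[of _ "\<lambda>k. u' k - v' k"])
    qed
    show "(\<lambda>k. K * v k) \<in> L'" if "v \<in> int_vec N" for v
      using mult_mem[OF full[OF that], of m] LL' by (auto simp: K_def mult_ac)
  qed (use zero_mem LL' K in \<open>auto simp: L'_def\<close>)
  have "L' = int_vec N"
  proof (rule ccontr)
    assume "L' \<noteq> int_vec N"
    then obtain f i where f: "i < N" "\<not> K dvd f i" "\<And>v. v \<in> L' \<Longrightarrow> K dvd (\<Sum>k<N. f k * v k)"
      using proper_lattice_has_character[OF \<open>full_int_lattice N L' K\<close>] by blast
    define g where "g = (\<lambda>k\<in>{..<N}. f k mod K)"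
    have "K dvd (\<Sum>k<N. g k * v k)" if "v \<in> L'" for v
    proof -
      have "(\<Sum>k<N. g k * v k) mod K = (\<Sum>k<N. ((f k mod K) * v k) mod K) mod K"
        by (simp add: mod_sum_eq g_def)
      also have "\<dots> = (\<Sum>k<N. f k * v k) mod K"
        by (simp only: mod_mult_left_eq mod_sum_eq)
      finally show ?thesis using f(3)[OF that] by (simp add: dvd_eq_mod_eq_0)
    qed
    moreover have "g k = 0" if "k \<in> B" for k
    proof -
      have "k < N" using that B(2) by auto
      have "(\<lambda>l. if l = k then 1 else 0) \<in> L'"
        using zero_mem that \<open>k < N\<close> by (auto simp: L'_def int_vec_def intro!: bexI[of _ "\<lambda>_. 0"])
      from f(3)[OF this] have "K dvd f k"
        using \<open>k < N\<close> by (simp add: if_distrib cong: if_cong)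
      then show ?thesis using \<open>k < N\<close> by (simp add: g_def dvd_eq_mod_eq_0)
    qed
    ultimately have "g \<in> annihilator N L K B"
      using LL' K by (auto simp: annihilator_def g_def)
    then have "g i = 0" using B(3) f(1) by (auto simp: trivial_annihilator_def)
    then show False using f(1,2) by (simp add: g_def dvd_eq_mod_eq_0)
  qed
  show ?thesis
  proof (rule that[of A "B - A"])
    show "2 ^ card A \<le> card (annihilator N L (fact P) {})"
      using A(3) by (simp add: \<phi>_def m_def)
    show "\<exists>u\<in>L. \<forall>k<N. k \<notin> A \<union> (B - A) \<longrightarrow> v k = u k" if "v \<in> int_vec N" for v
    proof -
      have "v \<in> L'" using that \<open>L' = int_vec N\<close> by simp
      moreover have "A \<union> (B - A) = B" using B(1) by auto
      ultimately show ?thesis by (simp add: L'_def)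
    qed
  qed (use A B BD in auto)
qed

section \<open>First homology of a hypertree as a lattice quotient\<close>

declare One_nat_def [simp del]

section \<open>The boundary maps on edges and triangles\<close>

lemma simplicial_boundary_add: "simplicial_boundary p (a + b) = simplicial_boundary p a + simplicial_boundary p b"
  by (simp add: simplicial_boundary_def frag_extend_add)

lemma simplicial_boundary_diff: "simplicial_boundary p (a - b) = simplicial_boundary p a - simplicial_boundary p b"
  by (simp add: simplicial_boundary_def frag_extend_diff)

lemma simplicial_boundary_cmul: "simplicial_boundary p (frag_cmul c a) = frag_cmul c (simplicial_boundary p a)"
  by (simp add: simplicial_boundary_def frag_extend_cmul)

lemma simplicial_boundary_0 [simp]: "simplicial_boundary p 0 = 0"
  by (simp add: simplicial_boundary_def)

lemma lookup_simplicial_boundary: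
  "Poly_Mapping.lookup (simplicial_boundary p c) e
     = (\<Sum>\<sigma>\<in>Poly_Mapping.keys c. Poly_Mapping.lookup c \<sigma> * Poly_Mapping.lookup (simplicial_boundary p (frag_of \<sigma>)) e)"
  by (simp add: simplicial_boundary_def frag_extend_def lookup_sum)

lemma simplicial_boundary_frag_of:
  "p > 0 \<Longrightarrow> simplicial_boundary p (frag_of \<sigma>)
     = (\<Sum>i\<le>p. frag_cmul ((-1) ^ i) (frag_of (\<sigma> - {sorted_list_of_set \<sigma> ! i})))"
  by (simp add: simplicial_boundary_def)

lemma card_3_linorderE:
  fixes t :: "'a::linorder set"
  assumes "card t = 3"
  obtains x y z where "t = {x, y, z}" "x < y" "y < z"
proof -
  have "finite t" using assms card.infinite by fastforce
  let ?l = "sorted_list_of_set t"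
  have l: "length ?l = 3" "set ?l = t" "sorted_wrt (<) ?l"
    using assms \<open>finite t\<close> by (auto simp: strict_sorted_list_of_set)
  have "\<exists>x y z. l = [x, y, z]" if "length l = 3" for l :: "'a list"
    using that by (auto simp: numeral_3_eq_3 length_Suc_conv)
  from this[OF l(1)] obtain x y z where "?l = [x, y, z]" by blast
  then show ?thesis using l that[of x y z] by auto
qed

lemma card_2_linorderE:
  fixes t :: "'a::linorder set"
  assumes "card t = 2"
  obtains x y where "t = {x, y}" "x < y"
  using assms by (metis card_2_iff insert_commute linorder_neqE)

lemma boundary_edge:
  fixes x y :: "'a::linorder"
  assumes "x < y"
  shows "simplicial_boundary 1 (frag_of {x, y}) = frag_of {y} - frag_of {x}"
proof -
  have "sorted_list_of_set (set [x, y]) = [x, y]"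
    by (rule sorted_list_of_set.idem_if_sorted_distinct) (use assms in auto)
  then have "sorted_list_of_set {x, y} = [x, y]" by (simp only: list.set)
  moreover have "{x, y} - {x} = {y}" "{x, y} - {y} = {x}" using assms by auto
  ultimately show ?thesis by (simp add: simplicial_boundary_frag_of One_nat_def)
qed

lemma boundary_triangle:
  fixes x y z :: "'a::linorder"
  assumes "x < y" "y < z"
  shows "simplicial_boundary 2 (frag_of {x, y, z}) = frag_of {y, z} - frag_of {x, z} + frag_of {x, y}"
proof -
  have "sorted_list_of_set (set [x, y, z]) = [x, y, z]"
    by (rule sorted_list_of_set.idem_if_sorted_distinct) (use assms in auto)
  then have "sorted_list_of_set {x, y, z} = [x, y, z]" by (simp only: list.set)
  moreover have "{x, y, z} - {x} = {y, z}" "{x, y, z} - {y} = {x, z}" "{x, y, z} - {z} = {x, y}"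
    using assms by auto
  ultimately show ?thesis by (simp add: simplicial_boundary_frag_of numeral_2_eq_2)
qed

lemma boundary_boundary_triangle:
  assumes "card t = 3" shows "simplicial_boundary 1 (simplicial_boundary 2 (frag_of t)) = 0"
proof -
  obtain x y z where "t = {x, y, z}" "x < y" "y < z" using card_3_linorderE[OF assms] .
  then show ?thesis
    by (simp add: boundary_triangle simplicial_boundary_diff simplicial_boundary_add boundary_edge)
qed

definition incidence :: "'v::linorder set \<Rightarrow> 'v set \<Rightarrow> int" where
  "incidence t e = Poly_Mapping.lookup (simplicial_boundary 2 (frag_of t)) e"

text \<open>The estimates below see the boundary matrix only through the absolute values of its
  entries, so the orientation signs disappear at this point.\<close>

lemma abs_incidence:
  assumes "card t = 3"
  shows "\<bar>incidence t e\<bar> = (if e \<subseteq> t \<and> card e = 2 then 1 else 0)"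
proof -
  obtain x y z where t: "t = {x, y, z}" "x < y" "y < z" using card_3_linorderE[OF assms] .
  have "e \<subseteq> t \<and> card e = 2 \<longleftrightarrow> e = {y, z} \<or> e = {x, z} \<or> e = {x, y}"
  proof
    assume e: "e \<subseteq> t \<and> card e = 2"
    then obtain u v where "e = {u, v}" "u < v" using card_2_linorderE by blast
    then show "e = {y, z} \<or> e = {x, z} \<or> e = {x, y}" using e t by auto
  qed (use t in auto)
  moreover have "{y, z} \<noteq> {x, z}" "{y, z} \<noteq> {x, y}" "{x, z} \<noteq> {x, y}"
    using t by (auto simp: doubleton_eq_iff)
  ultimately show ?thesis
    using t by (auto simp: incidence_def boundary_triangle lookup_add lookup_minus)
qed

text \<open>The complement of a spanning tree, the star at vertex 1, so that cycles are determined
  by their values here. There are as many of these edges as triangles in a hypertree, which makes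
  the reduced boundary matrix square.\<close>

definition vertex1_free_edges :: "nat \<Rightarrow> nat set set" where
  "vertex1_free_edges n = {e. e \<subseteq> {2..n} \<and> card e = 2}"

lemma finite_vertex1_free_edges: "finite (vertex1_free_edges n)"
  unfolding vertex1_free_edges_def by (rule finite_subset[of _ "Pow {2..n}"]) auto

lemma card_vertex1_free_edges: "n \<ge> 1 \<Longrightarrow> card (vertex1_free_edges n) = (n - 1) choose 2"
  unfolding vertex1_free_edges_def by (subst n_subsets) (auto simp: numeral_2_eq_2 One_nat_def)

text \<open>Such a cycle is supported on the star at vertex 1, where a leaf \<open>y\<close>
  receives boundary only from the edge \<open>{1, y}\<close>.\<close>

lemma cycle_eq_0:
  fixes c :: "nat set \<Rightarrow>\<^sub>0 int"
  assumes keys: "\<And>e. e \<in> Poly_Mapping.keys c \<Longrightarrow> e \<subseteq> {1..n} \<and> card e = 2"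
    and cyc: "simplicial_boundary 1 c = 0"
    and zero: "\<And>e. e \<in> vertex1_free_edges n \<Longrightarrow> Poly_Mapping.lookup c e = 0"
  shows "c = 0"
proof (rule ccontr)
  assume "c \<noteq> 0"
  have form: "\<exists>y. e = {1, y} \<and> 1 < y" if e_mem: "e \<in> Poly_Mapping.keys c" for e
  proof -
    obtain x y where e: "e = {x, y}" "x < y" using keys[OF e_mem] card_2_linorderE by blast
    have "x = 1"
    proof (rule ccontr)
      assume "x \<noteq> 1"
      then have "e \<in> vertex1_free_edges n" using keys[OF e_mem] e by (auto simp: vertex1_free_edges_def)
      then show False using zero e_mem by (simp add: in_keys_iff)
    qed
    then show ?thesis using e by auto
  qed
  obtain e where e: "e \<in> Poly_Mapping.keys c" using \<open>c \<noteq> 0\<close> keys_eq_empty by blast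
  then obtain y where y: "e = {1, y}" "1 < y" using form by blast
  have "0 = Poly_Mapping.lookup (simplicial_boundary 1 c) {y}" by (simp add: cyc)
  also have "\<dots> = (\<Sum>\<sigma>\<in>Poly_Mapping.keys c. Poly_Mapping.lookup c \<sigma> * (if \<sigma> = e then 1 else 0))"
    unfolding lookup_simplicial_boundary[of 1 c]
  proof (intro sum.cong refl arg_cong2[of _ _ _ _ "(*)"])
    fix \<sigma> assume "\<sigma> \<in> Poly_Mapping.keys c"
    then obtain w where w: "\<sigma> = {1, w}" "1 < w" using form by blast
    have "\<sigma> = e \<longleftrightarrow> w = y" using w y by (auto simp: doubleton_eq_iff)
    then show "Poly_Mapping.lookup (simplicial_boundary 1 (frag_of \<sigma>)) {y} = (if \<sigma> = e then 1 else 0)"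
      using w y by (simp add: boundary_edge lookup_minus)
  qed
  also have "\<dots> = (\<Sum>\<sigma>\<in>Poly_Mapping.keys c. if \<sigma> = e then Poly_Mapping.lookup c e else 0)"
    by (intro sum.cong) auto
  also have "\<dots> = Poly_Mapping.lookup c e" using e by (simp add: sum.delta)
  finally show False using e by (simp add: in_keys_iff)
qed

section \<open>The homology group of a fixed hypertree in coordinates\<close>

locale hypertree =
  fixes n :: nat and S :: "nat set set" and N :: nat and h :: "nat \<Rightarrow> nat set"
  assumes n: "n \<ge> 1" and S: "S \<in> hypertrees n"
    and h: "bij_betw h {..<N} (vertex1_free_edges n)"
begin

abbreviation "H \<equiv> simplicial_homology_group 1 S"
abbreviation "fcoeff \<equiv> Poly_Mapping.lookup"

definition "cycles = {c. Poly_Mapping.keys c \<subseteq> faces 1 S \<and> simplicial_boundary 1 c = 0}"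
definition "boundaries = simplicial_boundary 2 ` {c. Poly_Mapping.keys c \<subseteq> faces 2 S}"
definition "coset a = (\<lambda>b. b + a) ` boundaries" for a :: "nat set \<Rightarrow>\<^sub>0 int"
text \<open>On cycles this is an isomorphism onto Z^N, with inverse \<open>lift\<close>.\<close>

definition "res c = (\<lambda>k. if k < N then fcoeff c (h k) else 0)" for c :: "nat set \<Rightarrow>\<^sub>0 int"
text \<open>The triangle \<open>insert 1 e\<close> need not be a face of \<open>S\<close>, so this
  cycle need not be a boundary in \<open>S\<close>. The classes of these cycles will generate the
  homology group.\<close>

definition "apex_cone e = simplicial_boundary 2 (frag_of (insert 1 e))" for e :: "nat set"
definition "lift v = (\<Sum>k<N. frag_cmul (v k) (apex_cone (h k)))"

lemma face_subset: "\<sigma> \<in> S \<Longrightarrow> \<sigma> \<subseteq> {1..n}"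
  using S unfolding hypertrees_def simplicial_complex_on_def by blast

lemma edge_mem: "e \<subseteq> {1..n} \<Longrightarrow> card e = 2 \<Longrightarrow> e \<in> S"
  using S unfolding hypertrees_def by blast

lemma faces_1: "faces 1 S = {e. e \<subseteq> {1..n} \<and> card e = 2}"
  using face_subset edge_mem unfolding faces_def by (simp add: one_add_one) blast

lemma faces_2: "t \<in> faces 2 S \<Longrightarrow> t \<subseteq> {1..n} \<and> card t = 3"
  using face_subset[of t] by (simp add: faces_def)

lemma finite_faces_2: "finite (faces 2 S)"
  by (rule finite_subset[of _ "Pow {1..n}"]) (use faces_2 in auto)

lemma N_eq: "N = (n - 1) choose 2"
  using bij_betw_same_card[OF h] card_vertex1_free_edges[OF n] by simp

lemma card_faces_2: "card (faces 2 S) = N"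
  using S unfolding hypertrees_def N_eq by blast

lemma h_mem: "k < N \<Longrightarrow> h k \<subseteq> {2..n} \<and> card (h k) = 2"
  using bij_betwE[OF h] by (auto simp: vertex1_free_edges_def)

lemma triangle_boundary_in_cycles:
  assumes "t \<subseteq> {1..n}" "card t = 3" shows "simplicial_boundary 2 (frag_of t) \<in> cycles"
proof -
  have "e \<subseteq> {1..n} \<and> card e = 2" if "e \<in> Poly_Mapping.keys (simplicial_boundary 2 (frag_of t))" for e
    using that abs_incidence[OF assms(2), of e] assms(1)
    by (auto simp: incidence_def in_keys_iff split: if_splits)
  then show ?thesis using boundary_boundary_triangle[OF assms(2)] by (auto simp: cycles_def faces_1)
qed

lemma cycles_0: "0 \<in> cycles"
  by (simp add: cycles_def)

lemma cycles_add: "a \<in> cycles \<Longrightarrow> b \<in> cycles \<Longrightarrow> a + b \<in> cycles"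
  using keys_add[of a b] by (auto simp: cycles_def simplicial_boundary_add)

lemma cycles_diff: "a \<in> cycles \<Longrightarrow> b \<in> cycles \<Longrightarrow> a - b \<in> cycles"
  using keys_diff[of a b] by (auto simp: cycles_def simplicial_boundary_diff)

lemma cycles_cmul: "a \<in> cycles \<Longrightarrow> frag_cmul c a \<in> cycles"
  by (auto simp: cycles_def simplicial_boundary_cmul)

lemma cycles_sum: "(\<And>i. i \<in> I \<Longrightarrow> g i \<in> cycles) \<Longrightarrow> (\<Sum>i\<in>I. g i) \<in> cycles"
  by (induction I rule: infinite_finite_induct) (auto simp: cycles_0 cycles_add)

lemma boundary_expansion:
  assumes "Poly_Mapping.keys c \<subseteq> faces 2 S"
  shows "simplicial_boundary 2 c = (\<Sum>t\<in>faces 2 S. frag_cmul (fcoeff c t) (simplicial_boundary 2 (frag_of t)))"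
proof -
  have "simplicial_boundary 2 c = (\<Sum>t\<in>Poly_Mapping.keys c. frag_cmul (fcoeff c t) (simplicial_boundary 2 (frag_of t)))"
    by (simp add: simplicial_boundary_def frag_extend_def)
  also have "\<dots> = (\<Sum>t\<in>faces 2 S. frag_cmul (fcoeff c t) (simplicial_boundary 2 (frag_of t)))"
    using assms finite_faces_2 by (intro sum.mono_neutral_left) (auto simp: in_keys_iff)
  finally show ?thesis .
qed

lemma boundaries_subset: "boundaries \<subseteq> cycles"
proof -
  have "simplicial_boundary 2 c \<in> cycles" if "Poly_Mapping.keys c \<subseteq> faces 2 S" for c
    unfolding boundary_expansion[OF that]
    by (intro cycles_sum cycles_cmul triangle_boundary_in_cycles) (use faces_2 in blast)+
  then show ?thesis by (auto simp: boundaries_def)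
qed

lemma boundaries_0: "0 \<in> boundaries"
  unfolding boundaries_def by (rule image_eqI[of _ _ 0]) auto

lemma boundaries_diff: "a \<in> boundaries \<Longrightarrow> b \<in> boundaries \<Longrightarrow> a - b \<in> boundaries"
proof -
  assume "a \<in> boundaries" "b \<in> boundaries"
  then obtain c d where "a = simplicial_boundary 2 c" "b = simplicial_boundary 2 d"
      "Poly_Mapping.keys c \<subseteq> faces 2 S" "Poly_Mapping.keys d \<subseteq> faces 2 S"
    by (auto simp: boundaries_def)
  then show ?thesis
    using keys_diff[of c d] unfolding boundaries_def
    by (intro image_eqI[of _ _ "c - d"]) (auto simp: simplicial_boundary_diff)
qed

lemma boundaries_add: "a \<in> boundaries \<Longrightarrow> b \<in> boundaries \<Longrightarrow> a + b \<in> boundaries"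
  using boundaries_diff[of a "0 - b"] boundaries_diff[OF boundaries_0, of b] by simp

lemma coset_eq_iff: "coset a = coset a' \<longleftrightarrow> a - a' \<in> boundaries"
proof
  assume "coset a = coset a'"
  moreover have "a \<in> coset a" unfolding coset_def by (rule image_eqI[of _ _ 0]) (simp_all add: boundaries_0)
  ultimately obtain b where "b \<in> boundaries" "a = b + a'" by (auto simp: coset_def)
  then show "a - a' \<in> boundaries" by simp
next
  assume d: "a - a' \<in> boundaries"
  have "b + a \<in> coset a'" if "b \<in> boundaries" for b
    unfolding coset_def by (rule image_eqI[of _ _ "b + (a - a')"]) (simp_all add: that d boundaries_add)
  moreover have "b + a' \<in> coset a" if "b \<in> boundaries" for b
    unfolding coset_def by (rule image_eqI[of _ _ "b - (a - a')"]) (simp_all add: that d boundaries_diff)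
  ultimately show "coset a = coset a'" by (auto simp: coset_def)
qed

lemma subgroup_cycles: "subgroup cycles (simplicial_chain_group 1 S)"
proof (rule group.subgroupI)
  show "Group.group (simplicial_chain_group 1 S)" by (simp add: simplicial_chain_group_def)
  show "inv\<^bsub>simplicial_chain_group 1 S\<^esub> a \<in> cycles" if "a \<in> cycles" for a
    using that cycles_diff[OF cycles_0 that] by (auto simp: simplicial_chain_group_def cycles_def)
  show "cycles \<subseteq> carrier (simplicial_chain_group 1 S)"
    by (auto simp: simplicial_chain_group_def cycles_def)
  show "cycles \<noteq> {}" using cycles_0 by blast
  show "a \<otimes>\<^bsub>simplicial_chain_group 1 S\<^esub> b \<in> cycles" if "a \<in> cycles" "b \<in> cycles" for a b
    using cycles_add[OF that] by (simp add: simplicial_chain_group_def)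
qed

lemma cycle_group_eq: "simplicial_cycle_group 1 S = subgroup_generated (simplicial_chain_group 1 S) cycles"
  by (simp add: simplicial_cycle_group_def cycles_def simplicial_chain_group_def)

lemma carrier_cycle_group: "carrier (simplicial_cycle_group 1 S) = cycles"
  unfolding cycle_group_eq by (rule subgroup.carrier_subgroup_generated_subgroup[OF subgroup_cycles])

lemma mult_cycle_group: "x \<otimes>\<^bsub>simplicial_cycle_group 1 S\<^esub> y = x + y"
  by (simp add: cycle_group_eq simplicial_chain_group_def)

lemma comm_group_cycle_group: "comm_group (simplicial_cycle_group 1 S)"
  unfolding cycle_group_eq simplicial_chain_group_def
  by (rule group.abelian_subgroup_generated) (simp_all add: abelian_free_Abelian_group)

lemma homology_eq: "H = simplicial_cycle_group 1 S Mod boundaries"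
proof -
  have "carrier (free_Abelian_group X) = {c. Poly_Mapping.keys c \<subseteq> X}" for X :: "nat set set"
    by auto
  then show ?thesis
    by (simp add: simplicial_homology_group_def boundaries_def simplicial_chain_group_def Suc_1)
qed

lemma r_coset_eq: "boundaries #>\<^bsub>simplicial_cycle_group 1 S\<^esub> a = coset a"
  by (auto simp: r_coset_def coset_def mult_cycle_group)

lemma boundaries_normal: "boundaries \<lhd> simplicial_cycle_group 1 S"
proof (rule comm_group.subgroup_imp_normal[OF comm_group_cycle_group])
  interpret G: comm_group "simplicial_cycle_group 1 S" by (rule comm_group_cycle_group)
  have one: "\<one>\<^bsub>simplicial_cycle_group 1 S\<^esub> = 0"
    by (simp add: cycle_group_eq simplicial_chain_group_def)
  show "subgroup boundaries (simplicial_cycle_group 1 S)"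
  proof (rule G.subgroupI)
    show "inv\<^bsub>simplicial_cycle_group 1 S\<^esub> a \<in> boundaries" if "a \<in> boundaries" for a
    proof -
      have "inv\<^bsub>simplicial_cycle_group 1 S\<^esub> a = 0 - a"
        using that boundaries_subset cycles_diff[OF cycles_0, of a]
        by (intro G.inv_equality) (auto simp: mult_cycle_group one carrier_cycle_group)
      then show ?thesis using boundaries_diff[OF boundaries_0 that] by simp
    qed
    show "boundaries \<subseteq> carrier (simplicial_cycle_group 1 S)"
      using boundaries_subset by (simp add: carrier_cycle_group)
    show "boundaries \<noteq> {}" using boundaries_0 by blast
    show "a \<otimes>\<^bsub>simplicial_cycle_group 1 S\<^esub> b \<in> boundaries" if "a \<in> boundaries" "b \<in> boundaries" for a b
      using boundaries_add[OF that] by (simp add: mult_cycle_group)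
  qed
qed

lemma group_homology: "Group.group H"
  unfolding homology_eq by (rule normal.factorgroup_is_group[OF boundaries_normal])

lemma carrier_homology: "carrier H = coset ` cycles"
proof -
  have "carrier H = rcosets\<^bsub>simplicial_cycle_group 1 S\<^esub> boundaries"
    by (simp only: homology_eq FactGroup_def partial_object.select_convs)
  then show ?thesis
    unfolding RCOSETS_def r_coset_eq carrier_cycle_group by blast
qed

lemma mult_homology:
  assumes "a \<in> cycles" "b \<in> cycles"
  shows "coset a \<otimes>\<^bsub>H\<^esub> coset b = coset (a + b)"
proof -
  have "coset a <#>\<^bsub>simplicial_cycle_group 1 S\<^esub> coset b = coset (a + b)"
    using normal.rcos_sum[OF boundaries_normal, of a b] assms
    by (simp only: r_coset_eq carrier_cycle_group mult_cycle_group)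
  then show ?thesis
    by (simp only: homology_eq FactGroup_def monoid.select_convs)
qed

lemma finite_homology: "finite (carrier H)"
  using S unfolding hypertrees_def by blast

lemma res_diff: "res (a - b) = (\<lambda>k. res a k - res b k)"
  by (auto simp: res_def lookup_minus)

lemma res_cmul: "res (frag_cmul c a) = (\<lambda>k. c * res a k)"
  by (auto simp: res_def)

lemma res_sum: "res (\<Sum>i\<in>I. g i) = (\<lambda>k. \<Sum>i\<in>I. res (g i) k)"
  by (auto simp: res_def lookup_sum)

lemma res_in_int_vec: "res c \<in> int_vec N"
  by (simp add: res_def int_vec_def)

lemma res_eq_0_imp:
  assumes c: "c \<in> cycles" and r: "\<And>k. k < N \<Longrightarrow> res c k = 0"
  shows "c = 0"
proof (rule cycle_eq_0[of c n])
  show "e \<subseteq> {1..n} \<and> card e = 2" if "e \<in> Poly_Mapping.keys c" for e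
    using that c by (auto simp: cycles_def faces_1)
  show "simplicial_boundary 1 c = 0" using c by (simp add: cycles_def)
  show "fcoeff c e = 0" if "e \<in> vertex1_free_edges n" for e
  proof -
    have "e \<in> h ` {..<N}" using that bij_betw_imp_surj_on[OF h] by simp
    then obtain k where "k < N" "e = h k" by auto
    then show ?thesis using r[of k] by (simp add: res_def)
  qed
qed

lemma cone_in_cycles:
  assumes k: "k < N" shows "apex_cone (h k) \<in> cycles"
  unfolding apex_cone_def
proof (rule triangle_boundary_in_cycles)
  show "insert 1 (h k) \<subseteq> {1..n}" using h_mem[OF k] n by auto
  have "finite (h k)" using h_mem[OF k] finite_subset by blast
  moreover have "1 \<notin> h k" using h_mem[OF k] by auto
  ultimately show "card (insert 1 (h k)) = 3" using h_mem[OF k] by simp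
qed

text \<open>Vertex 1 is the smallest vertex, so in the boundary of a cone the opposite edge has sign
  +1, while the two other edges pass through vertex 1 and are dropped.\<close>

lemma res_cone:
  assumes k: "k < N" shows "res (apex_cone (h k)) = (\<lambda>j. if j = k then 1 else 0)"
proof
  fix j
  obtain x y where xy: "h k = {x, y}" "x < y" using h_mem[OF k] card_2_linorderE by blast
  have x: "1 < x" using h_mem[OF k] xy by auto
  show "res (apex_cone (h k)) j = (if j = k then 1 else 0)"
  proof (cases "j < N")
    case True
    have "1 \<notin> h j" using h_mem[OF True] by auto
    then have ne: "h j \<noteq> {1, y}" "h j \<noteq> {1, x}" by auto
    have "res (apex_cone (h k)) j = fcoeff (frag_of {x, y} - frag_of {1, y} + frag_of {1, x}) (h j)"
      using True x xy(2) by (simp only: res_def if_True apex_cone_def xy(1) boundary_triangle)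
    also have "\<dots> = (if h j = h k then 1 else 0)"
      using ne by (simp add: lookup_add lookup_minus xy(1))
    also have "h j = h k \<longleftrightarrow> j = k"
      using bij_betw_imp_inj_on[OF h] k True by (simp add: inj_on_eq_iff)
    finally show ?thesis .
  next
    case False
    then show ?thesis using k by (simp add: res_def)
  qed
qed

lemma lift_in_cycles: "lift v \<in> cycles"
  unfolding lift_def by (intro cycles_sum cycles_cmul cone_in_cycles) simp

lemma res_lift: "k < N \<Longrightarrow> res (lift v) k = v k"
  by (simp add: lift_def res_sum res_cmul res_cone if_distrib cong: if_cong)

text \<open>The lattice of relations: homology becomes Z^N modulo \<open>L\<close>, and
  \<open>L\<close> is spanned by the columns of the boundary matrix without the rows at vertex
  1.\<close>

definition "L = res ` boundaries"

lemma res_mem_imp_coset_eq: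
  assumes a: "a \<in> cycles" "a' \<in> cycles" and u: "u \<in> L" and eq: "\<And>k. k < N \<Longrightarrow> res a k - res a' k = u k"
  shows "coset a = coset a'"
proof -
  obtain b where b: "b \<in> boundaries" "u = res b" using u by (auto simp: L_def)
  have "a - a' - b = 0"
    using a b boundaries_subset eq by (intro res_eq_0_imp cycles_diff) (auto simp: res_diff)
  then have "a - a' = b" by simp
  then show ?thesis using b by (simp add: coset_eq_iff)
qed

lemma int_lattice_L: "int_lattice N L"
proof
  show "L \<subseteq> int_vec N" using res_in_int_vec by (auto simp: L_def)
  show "(\<lambda>_. 0) \<in> L"
    unfolding L_def by (rule image_eqI[of _ _ 0]) (auto simp: res_def boundaries_0)
  show "(\<lambda>k. u k - v k) \<in> L" if uv: "u \<in> L" "v \<in> L" for u v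
  proof -
    obtain a b where "a \<in> boundaries" "b \<in> boundaries" "u = res a" "v = res b"
      using uv by (auto simp: L_def)
    then show ?thesis
      unfolding L_def by (intro image_eqI[of _ _ "a - b"]) (simp_all add: res_diff boundaries_diff)
  qed
qed

text \<open>Homology being finite, two distinct multiples of \<open>apex_cone (h k)\<close> are homologous.\<close>

lemma multiple_of_unit_in_L:
  assumes k: "k < N" shows "\<exists>d>0. (\<lambda>j. if j = k then int d else 0) \<in> L"
proof -
  let ?f = "\<lambda>i. coset (frag_cmul (int i) (apex_cone (h k)))"
  have "range ?f \<subseteq> carrier H"
    unfolding carrier_homology using cone_in_cycles[OF k] by (auto intro!: imageI cycles_cmul)
  then have "finite (range ?f)" using finite_homology finite_subset by blast
  then have "\<not> inj ?f" using finite_imageD infinite_UNIV_nat by blast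
  then obtain i' j' where ij': "i' \<noteq> j'" "?f i' = ?f j'" by (auto simp: inj_def)
  then obtain i j where ij: "i < j" "?f j = ?f i" by (metis linorder_neqE_nat)
  have "frag_cmul (int j) (apex_cone (h k)) - frag_cmul (int i) (apex_cone (h k)) \<in> boundaries"
    using ij(2) by (simp add: coset_eq_iff)
  then have "res (frag_cmul (int j - int i) (apex_cone (h k))) \<in> L"
    unfolding L_def frag_cmul_diff_distrib by (rule imageI)
  also have "res (frag_cmul (int j - int i) (apex_cone (h k))) = (\<lambda>l. if l = k then int (j - i) else 0)"
    using ij by (auto simp: res_cmul res_cone[OF k])
  finally show ?thesis using ij by (intro exI[of _ "j - i"]) simp
qed

lemma full_int_lattice_L: "\<exists>M. full_int_lattice N L M"
proof -
  interpret int_lattice N L by (rule int_lattice_L)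
  obtain d where d: "\<And>k. k < N \<Longrightarrow> d k > 0 \<and> (\<lambda>j. if j = k then int (d k) else 0) \<in> L"
    using multiple_of_unit_in_L by metis
  define M where "M = (\<Prod>k<N. int (d k))"
  have "(\<lambda>j. M * v j) \<in> L" if v: "v \<in> int_vec N" for v
  proof -
    define q where "q k = M div int (d k)" for k
    have q: "M = q k * int (d k)" if "k < N" for k
    proof -
      have "int (d k) dvd M" unfolding M_def using that by (intro dvd_prodI) auto
      then show ?thesis by (simp add: q_def)
    qed
    have "(\<lambda>j. \<Sum>k<N. v k * q k * (if j = k then int (d k) else 0)) \<in> L"
      using d by (intro sum_mem mult_mem) auto
    also have "(\<lambda>j. \<Sum>k<N. v k * q k * (if j = k then int (d k) else 0)) = (\<lambda>j. M * v j)"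
    proof
      fix j show "(\<Sum>k<N. v k * q k * (if j = k then int (d k) else 0)) = M * v j"
        using q[of j] v by (cases "j < N") (auto simp: if_distrib int_vec_def cong: if_cong)
    qed
    finally show ?thesis .
  qed
  moreover have "M > 0" unfolding M_def using d by (intro prod_pos) auto
  ultimately have "full_int_lattice N L M"
    by unfold_locales auto
  then show ?thesis ..
qed

lemma res_triangle: "res (simplicial_boundary 2 (frag_of t)) k = (if k < N then incidence t (h k) else 0)"
  by (simp add: res_def incidence_def)

lemma triangle_boundary_in_boundaries: "t \<in> faces 2 S \<Longrightarrow> simplicial_boundary 2 (frag_of t) \<in> boundaries"
  unfolding boundaries_def by (rule imageI) simp

text \<open>Extended by 0 to the edges at vertex 1, a functional is a 1-cochain. The boundaries of
  the triangles of \<open>S\<close> restrict to elements of \<open>L\<close>, so a functional that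
  kills \<open>L\<close> is a cocycle.\<close>

lemma annihilator_L:
  "annihilator N L m {} \<subseteq> {f \<in> PiE {..<N} (\<lambda>_. {0..<m}). \<forall>t\<in>faces 2 S. m dvd (\<Sum>k<N. f k * incidence t (h k))}"
proof
  fix f assume f: "f \<in> annihilator N L m {}"
  have "m dvd (\<Sum>k<N. f k * incidence t (h k))" if "t \<in> faces 2 S" for t
  proof -
    have "res (simplicial_boundary 2 (frag_of t)) \<in> L"
      unfolding L_def by (rule imageI[OF triangle_boundary_in_boundaries[OF that]])
    then have "m dvd (\<Sum>k<N. f k * res (simplicial_boundary 2 (frag_of t)) k)"
      using f by (auto simp: annihilator_def)
    then show ?thesis by (simp add: res_triangle)
  qed
  then show "f \<in> {f \<in> PiE {..<N} (\<lambda>_. {0..<m}). \<forall>t\<in>faces 2 S. m dvd (\<Sum>k<N. f k * incidence t (h k))}"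
    using f by (auto simp: annihilator_def)
qed

text \<open>By assumption every vector is congruent modulo \<open>L\<close> to one supported on
  \<open>B\<close>, so the classes of the cones over the edges \<open>h k\<close> with
  \<open>k\<close> in \<open>B\<close> generate.\<close>

lemma min_generators_le:
  assumes B: "B \<subseteq> {..<N}" and gen: "\<And>v. v \<in> int_vec N \<Longrightarrow> \<exists>u\<in>L. \<forall>k<N. k \<notin> B \<longrightarrow> v k = u k"
  shows "min_generators H \<le> card B"
proof -
  interpret H: group H by (rule group_homology)
  have finB: "finite B" using B finite_subset by blast
  define A where "A = (\<lambda>k. coset (apex_cone (h k))) ` B"
  have A: "A \<subseteq> carrier H"
    unfolding A_def carrier_homology using B cone_in_cycles by auto
  define W where "W = {a\<in>cycles. coset a \<in> generate H A}"
  have W0: "0 \<in> W"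
  proof -
    \<comment> \<open>The class of 0 is recognized as the unit of the quotient by being
      idempotent.\<close>
    have "coset 0 \<otimes>\<^bsub>H\<^esub> coset 0 = coset 0"
      using mult_homology[OF cycles_0 cycles_0] by simp
    moreover have "coset 0 \<in> carrier H" using cycles_0 by (auto simp: carrier_homology)
    ultimately have "coset 0 = \<one>\<^bsub>H\<^esub>" using H.r_cancel_one by metis
    then show ?thesis using cycles_0 by (simp add: W_def generate.one)
  qed
  have Wadd: "a + b \<in> W" if "a \<in> W" "b \<in> W" for a b
    using that cycles_add by (auto simp: W_def generate.eng simp flip: mult_homology)
  have Wneg: "- a \<in> W" if a: "a \<in> W" for a
  proof -
    have ac: "a \<in> cycles" "- a \<in> cycles" using a cycles_diff[OF cycles_0, of a] by (auto simp: W_def)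
    have "coset (- a) \<otimes>\<^bsub>H\<^esub> coset a = coset 0" using mult_homology[OF ac(2,1)] by simp
    moreover have "coset 0 \<otimes>\<^bsub>H\<^esub> coset 0 = coset 0"
      using mult_homology[OF cycles_0 cycles_0] by simp
    moreover have car: "coset 0 \<in> carrier H" "coset a \<in> carrier H" "coset (- a) \<in> carrier H"
      using cycles_0 ac by (auto simp: carrier_homology)
    ultimately have "coset (- a) = inv\<^bsub>H\<^esub> (coset a)"
      using H.r_cancel_one H.inv_equality by metis
    then show ?thesis
      using a ac A H.generate_m_inv_closed by (auto simp: W_def)
  qed
  have Wcmul: "frag_cmul c a \<in> W" if a: "a \<in> W" for c a
  proof (induction c rule: int_induct[where k=0])
    case (step1 i)
    then show ?case using Wadd[OF step1(2) a] by (simp add: frag_cmul_distrib)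
  next
    case (step2 i)
    then show ?case using Wadd[OF step2(2) Wneg[OF a]] by (simp add: frag_cmul_diff_distrib)
  qed (simp add: W0)
  have Wsum: "(\<Sum>k\<in>I. g k) \<in> W" if "\<And>k. k \<in> I \<Longrightarrow> g k \<in> W" for I :: "nat set" and g
    using that by (induction I rule: infinite_finite_induct) (auto simp: W0 Wadd)
  have "carrier H \<subseteq> generate H A"
  proof
    fix X assume "X \<in> carrier H"
    then obtain a where a: "a \<in> cycles" "X = coset a" by (auto simp: carrier_homology)
    obtain u where u: "u \<in> L" "\<And>k. k < N \<Longrightarrow> k \<notin> B \<Longrightarrow> res a k = u k"
      using gen[OF res_in_int_vec[of a]] by blast
    let ?c = "\<Sum>k\<in>B. frag_cmul (res a k - u k) (apex_cone (h k))"
    have apex_cone: "apex_cone (h k) \<in> W" if "k \<in> B" for k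
      using that B cone_in_cycles by (auto simp: W_def A_def intro!: generate.incl)
    then have c: "?c \<in> W" by (intro Wsum Wcmul)
    have "coset a = coset ?c"
    proof (rule res_mem_imp_coset_eq[OF a(1) _ u(1)])
      show "?c \<in> cycles" using c by (simp add: W_def)
      fix k assume k: "k < N"
      have "res ?c k = (\<Sum>l\<in>B. (res a l - u l) * res (apex_cone (h l)) k)"
        by (simp add: res_sum res_cmul)
      also have "\<dots> = (\<Sum>l\<in>B. if k = l then res a l - u l else 0)"
        using B res_cone by (intro sum.cong) (auto simp: subset_iff)
      also have "\<dots> = (if k \<in> B then res a k - u k else 0)" using finB by simp
      finally show "res a k - res ?c k = u k" using u(2)[OF k] by auto
    qed
    then show "X \<in> generate H A" using c a by (simp add: W_def)
  qed
  then have "generate H A = carrier H" using H.generate_incl[OF A] by auto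
  moreover have "finite A" using finB by (simp add: A_def)
  ultimately have "min_generators H \<le> card A"
    unfolding min_generators_def using A by (intro Least_le) auto
  also have "card A \<le> card B" unfolding A_def using finB by (rule card_image_le)
  finally show ?thesis .
qed

text \<open>The columns of the matrix generate \<open>L\<close>, so its determinant bounds the
  index. In the second claim, \<open>a\<close> unit vectors suffice to kill the functionals modulo
  \<open>fact P\<close>, and \<open>b\<close> further ones kill the rest.\<close>

lemma homology_bounds:
  fixes P :: nat
  assumes s: "bij_betw s {..<N} (faces 2 S)" and P: "P > 0"
  defines "\<Delta> \<equiv> Determinant.det (Matrix.mat N N (\<lambda>(k, j). incidence (s j) (h k)))"
  shows "int (card (carrier H)) \<le> \<bar>\<Delta>\<bar>"
    and "\<exists>a b. min_generators H \<le> a + b \<and> int ((P + 1) ^ b) \<le> \<bar>\<Delta>\<bar> \<and>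
      2 ^ a \<le> card {f \<in> PiE {..<N} (\<lambda>_. {0..<fact P :: int}). \<forall>t\<in>faces 2 S. fact P dvd (\<Sum>k<N. f k * incidence t (h k))}"
proof -
  obtain M where "full_int_lattice N L M" using full_int_lattice_L by blast
  then interpret L: full_int_lattice N L M .
  define c where "c j = res (simplicial_boundary 2 (frag_of (s j)))" for j
  have sj: "s j \<in> faces 2 S" if "j < N" for j using s that by (auto simp: bij_betw_def)
  have mat: "Matrix.mat N N (\<lambda>(k, j). c j k) = Matrix.mat N N (\<lambda>(k, j). incidence (s j) (h k))"
    by (rule eq_matI) (auto simp: c_def res_triangle)
  have cL: "c j \<in> L" if "j < N" for j
    unfolding c_def L_def by (rule imageI[OF triangle_boundary_in_boundaries[OF sj[OF that]]])
  have gen: "\<exists>y. \<forall>k<N. v k = (\<Sum>j<N. y j * c j k)" if "v \<in> L" for v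
  proof -
    obtain x where x: "Poly_Mapping.keys x \<subseteq> faces 2 S" "v = res (simplicial_boundary 2 x)"
      using \<open>v \<in> L\<close> by (auto simp: L_def boundaries_def)
    have "v k = (\<Sum>j<N. fcoeff x (s j) * c j k)" for k
      unfolding x(2) boundary_expansion[OF x(1)] res_sum res_cmul c_def
      by (rule sum.reindex_bij_betw[OF s, symmetric])
    then show ?thesis by (intro exI[of _ "\<lambda>j. fcoeff x (s j)"] allI impI)
  qed
  obtain D R where D: "int D \<le> \<bar>\<Delta>\<bar>" and R: "finite R" "card R \<le> D"
      "\<And>v. v \<in> int_vec N \<Longrightarrow> \<exists>r\<in>R. (\<lambda>k. v k - r k) \<in> L"
    and ann: "\<And>m. m > 0 \<Longrightarrow> card (annihilator N L m {}) \<le> D"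
    by (rule L.det_bound_index[of c, OF cL gen, unfolded mat, folded \<Delta>_def]) (assumption | rule that)+
  have "carrier H \<subseteq> (\<lambda>r. coset (lift r)) ` R"
  proof
    fix X assume "X \<in> carrier H"
    then obtain a where a: "a \<in> cycles" "X = coset a" by (auto simp: carrier_homology)
    obtain r where r: "r \<in> R" "(\<lambda>k. res a k - r k) \<in> L" using R(3)[OF res_in_int_vec] by blast
    have "coset a = coset (lift r)"
      using res_lift by (intro res_mem_imp_coset_eq[OF a(1) lift_in_cycles r(2)]) simp
    then show "X \<in> (\<lambda>r. coset (lift r)) ` R" using a r by blast
  qed
  then have "card (carrier H) \<le> card R" using R(1) surj_card_le by blast
  then show "int (card (carrier H)) \<le> \<bar>\<Delta>\<bar>" using R(2) D by linarith

  obtain A B where AB: "A \<subseteq> {..<N}" "B \<subseteq> {..<N}" "2 ^ card A \<le> card (annihilator N L (fact P) {})"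
      "(P + 1) ^ card B \<le> D" "\<And>v. v \<in> int_vec N \<Longrightarrow> \<exists>u\<in>L. \<forall>k<N. k \<notin> A \<union> B \<longrightarrow> v k = u k"
    using L.few_generators[OF P ann] by blast
  have "min_generators H \<le> card (A \<union> B)" using AB by (intro min_generators_le) auto
  also have "\<dots> \<le> card A + card B" by (rule card_Un_le)
  finally have "min_generators H \<le> card A + card B" .
  moreover have "int ((P + 1) ^ card B) \<le> \<bar>\<Delta>\<bar>" using AB(4) D by (metis of_nat_le_iff order_trans)
  moreover have "2 ^ card A \<le> card {f \<in> PiE {..<N} (\<lambda>_. {0..<fact P :: int}).
      \<forall>t\<in>faces 2 S. fact P dvd (\<Sum>k<N. f k * incidence t (h k))}"
  proof (rule order_trans[OF AB(3) card_mono[OF _ annihilator_L]])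
    show "finite {f \<in> PiE {..<N} (\<lambda>_. {0..<fact P :: int}). \<forall>t\<in>faces 2 S. fact P dvd (\<Sum>k<N. f k * incidence t (h k))}"
      by (rule finite_subset[of _ "PiE {..<N} (\<lambda>_. {0..<fact P :: int})"]) (auto intro: finite_PiE)
  qed
  ultimately show "\<exists>a b. min_generators H \<le> a + b \<and> int ((P + 1) ^ b) \<le> \<bar>\<Delta>\<bar> \<and>
      2 ^ a \<le> card {f \<in> PiE {..<N} (\<lambda>_. {0..<fact P :: int}). \<forall>t\<in>faces 2 S. fact P dvd (\<Sum>k<N. f k * incidence t (h k))}"
    by blast
qed

end

section \<open>Counting cocycles of the random hypertree\<close>

declare One_nat_def [simp]

section \<open>Determinant estimates for hypertrees\<close>

text \<open>The number of orderings of the triangles of one hypertree cancels the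
  \<open>fact N\<close> in the Cauchy-Binet formula over tuples.\<close>

lemma card_extensional_bijections:
  assumes "finite B" "card B = N"
  shows "card {s \<in> PiE {..<N} (\<lambda>_. B). bij_betw s {..<N} B} = fact N"
proof -
  have "bij_betw s {..<N} B \<longleftrightarrow> inj_on s {..<N}" if "s \<in> PiE {..<N} (\<lambda>_. B)" for s
  proof
    assume "inj_on s {..<N}"
    moreover have "s ` {..<N} \<subseteq> B" using that by auto
    ultimately show "bij_betw s {..<N} B"
      using assms by (simp add: bij_betw_def card_image card_subset_eq)
  qed (simp add: bij_betw_def)
  then have "{s \<in> PiE {..<N} (\<lambda>_. B). bij_betw s {..<N} B} = {s \<in> PiE {..<N} (\<lambda>_. B). inj_on s {..<N}}"
    by blast
  then show ?thesis
    using card_inj_on_subset_funcset[of "{..<N}" B "{..<N}"] assms by (simp add: fact_prod_rev)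
qed

lemma det_of_int:
  fixes f :: "nat \<Rightarrow> nat \<Rightarrow> int"
  shows "Determinant.det (Matrix.mat N N (\<lambda>(i, j). real_of_int (f i j)))
    = real_of_int (Determinant.det (Matrix.mat N N (\<lambda>(i, j). f i j)))"
proof -
  have "Matrix.mat N N (\<lambda>(i, j). real_of_int (f i j)) = map_mat real_of_int (Matrix.mat N N (\<lambda>(i, j). f i j))"
    by (rule eq_matI) auto
  then show ?thesis by (simp only: of_int_hom.hom_det)
qed

lemma hadamard_rows:
  fixes f :: "nat \<Rightarrow> nat \<Rightarrow> real"
  shows "(Determinant.det (Matrix.mat N N (\<lambda>(i, j). f i j)))\<^sup>2 \<le> (\<Prod>i<N. \<Sum>j<N. (f i j)\<^sup>2)"
proof -
  let ?M = "Matrix.mat N N (\<lambda>(i, j). f i j)"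
  have "Matrix.mat N N (\<lambda>(i, j). \<Sum>a<N. f i a * f j a) = ?M * transpose_mat ?M"
    by (rule eq_matI) (auto simp: scalar_prod_def atLeast0LessThan)
  then have "Determinant.det (Matrix.mat N N (\<lambda>(i, j). \<Sum>a<N. f i a * f j a)) = (Determinant.det ?M)\<^sup>2"
    by (simp add: det_mult[of _ N] det_transpose[of _ N] power2_eq_square)
  then show ?thesis using hadamard_gram[where A="{..<N}" and r=f and N=N] by simp
qed

text \<open>The inequality between the means, in the form
  \<open>x \<le> 3 * exp (x / 3 - 1)\<close>. The 3 is the number of edges of a triangle.\<close>

lemma prod_le_power_3:
  fixes x :: "'i \<Rightarrow> real"
  assumes "finite I" "\<And>i. i \<in> I \<Longrightarrow> x i \<ge> 0" "(\<Sum>i\<in>I. x i) \<le> 3 * real (card I)"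
  shows "(\<Prod>i\<in>I. x i) \<le> 3 ^ card I"
proof -
  have "(\<Prod>i\<in>I. x i) \<le> (\<Prod>i\<in>I. 3 * exp (x i / 3 - 1))"
  proof (rule prod_mono, safe)
    fix i assume "i \<in> I"
    then show "0 \<le> x i" by (rule assms)
    show "x i \<le> 3 * exp (x i / 3 - 1)" using exp_ge_add_one_self[of "x i / 3 - 1"] by simp
  qed
  also have "\<dots> = 3 ^ card I * exp ((\<Sum>i\<in>I. x i) / 3 - real (card I))"
    using assms(1) by (simp add: prod.distrib sum_subtractf sum_divide_distrib flip: exp_sum)
  also have "\<dots> \<le> 3 ^ card I * exp 0"
    using assms(3) by (intro mult_left_mono) auto
  finally show ?thesis by simp
qed

lemma incidence_squared:
  assumes "card t = 3" "card e = 2"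
  shows "(real_of_int (incidence t e))\<^sup>2 = (if e \<subseteq> t then 1 else 0)"
proof -
  have "(real_of_int (incidence t e))\<^sup>2 = (real_of_int \<bar>incidence t e\<bar>)\<^sup>2" by simp
  also have "\<dots> = (if e \<subseteq> t then 1 else 0)"
    unfolding abs_incidence[OF assms(1)] using assms(2) by simp
  finally show ?thesis .
qed

lemma finite_hypertrees: "finite (hypertrees n)"
proof (rule finite_subset)
  show "hypertrees n \<subseteq> Pow (Pow {1..n})"
    unfolding hypertrees_def simplicial_complex_on_def by blast
qed simp

text \<open>A hypertree is determined by its triangles. Hence a tuple of columns that enumerates the
  triangles of a hypertree belongs to only one of them.\<close>

lemma (in hypertree) eq_low_faces_Un: "S = {\<sigma>. \<sigma> \<noteq> {} \<and> \<sigma> \<subseteq> {1..n} \<and> card \<sigma> \<le> 2} \<union> faces 2 S"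
proof -
  have dim: "card \<sigma> \<le> 3" "\<sigma> \<noteq> {}" if "\<sigma> \<in> S" for \<sigma>
    using S that unfolding hypertrees_def simplicial_complex_on_def by blast+
  have vertex: "{v} \<in> S" if "v \<in> {1..n}" for v
    using S that unfolding hypertrees_def simplicial_complex_on_def by blast
  have low: "\<sigma> \<in> S" if \<sigma>: "\<sigma> \<noteq> {}" "\<sigma> \<subseteq> {1..n}" "card \<sigma> \<le> 2" for \<sigma>
  proof -
    have "finite \<sigma>" using \<sigma>(2) finite_subset by blast
    then have "card \<sigma> \<noteq> 0" using \<sigma>(1) by simp
    then consider "card \<sigma> = 1" | "card \<sigma> = 2" using \<sigma>(3) by linarith
    then show ?thesis
    proof cases
      case 1
      then obtain v where "\<sigma> = {v}" by (rule card_1_singletonE)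
      then show ?thesis using vertex \<sigma>(2) by simp
    qed (use edge_mem \<sigma> in blast)
  qed
  show ?thesis
  proof (intro equalityI subsetI)
    fix \<sigma> assume \<sigma>: "\<sigma> \<in> S"
    have "card \<sigma> \<le> 2 \<or> \<sigma> \<in> faces 2 S" using dim(1)[OF \<sigma>] \<sigma> by (auto simp: faces_def)
    then show "\<sigma> \<in> {\<sigma>. \<sigma> \<noteq> {} \<and> \<sigma> \<subseteq> {1..n} \<and> card \<sigma> \<le> 2} \<union> faces 2 S"
      using dim(2)[OF \<sigma>] face_subset[OF \<sigma>] by simp
  next
    fix \<sigma> assume "\<sigma> \<in> {\<sigma>. \<sigma> \<noteq> {} \<and> \<sigma> \<subseteq> {1..n} \<and> card \<sigma> \<le> 2} \<union> faces 2 S"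
    then show "\<sigma> \<in> S" using low by (auto simp: faces_def)
  qed
qed

text \<open>The enumeration of the rows is shared by all hypertrees on the same vertices, so their
  determinants are minors of one matrix.\<close>

locale enumeration =
  fixes n N :: nat and h :: "nat \<Rightarrow> nat set"
  assumes n: "n \<ge> 1" and h: "bij_betw h {..<N} (vertex1_free_edges n)"
begin

lemma hypertree: "S \<in> hypertrees n \<Longrightarrow> hypertree n S N h"
  by unfold_locales (use n h in auto)

definition homology_order :: "nat set set \<Rightarrow> nat" where
  "homology_order S = card (carrier (simplicial_homology_group 1 S))"

text \<open>Up to Kalai's constant, the left side is the probability that all triangles of the
  random hypertree lie in \<open>\<A>\<close>. Bounding each order by a determinant and summing over
  all tuples of columns from \<open>\<A>\<close> gives a Gram determinant. Its diagonal entries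
  count the triangles of \<open>\<A>\<close> that contain a given edge.\<close>

lemma sum_homology_order_squared_le:
  assumes \<A>: "\<And>t. t \<in> \<A> \<Longrightarrow> t \<subseteq> {1..n} \<and> card t = 3"
  shows "(\<Sum>S | S \<in> hypertrees n \<and> faces 2 S \<subseteq> \<A>. (real (homology_order S))\<^sup>2)
     \<le> (\<Prod>k<N. \<Sum>t\<in>\<A>. (real_of_int (incidence t (h k)))\<^sup>2)"
proof -
  let ?S = "{S. S \<in> hypertrees n \<and> faces 2 S \<subseteq> \<A>}"
  let ?det = "\<lambda>s. Determinant.det (Matrix.mat N N (\<lambda>(k, j). real_of_int (incidence (s j) (h k))))"
  let ?B = "\<lambda>S. {s \<in> PiE {..<N} (\<lambda>_. faces 2 S). bij_betw s {..<N} (faces 2 S)}"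
  have fin\<A>: "finite \<A>" by (rule finite_subset[of _ "Pow {1..n}"]) (use \<A> in auto)
  have finS: "finite ?S" using finite_hypertrees by simp
  have finB: "finite (?B S)" if "S \<in> ?S" for S
  proof -
    have "finite (faces 2 S)" using that fin\<A> finite_subset by blast
    then have "finite (PiE {..<N} (\<lambda>_. faces 2 S))" by (intro finite_PiE) auto
    then show ?thesis by (rule rev_finite_subset) blast
  qed
  have one: "fact N * (real (homology_order S))\<^sup>2 \<le> (\<Sum>s\<in>?B S. (?det s)\<^sup>2)" if S: "S \<in> ?S" for S
  proof -
    interpret hypertree n S N h using S by (intro hypertree) simp
    have "fact N * (real (homology_order S))\<^sup>2 = (\<Sum>s\<in>?B S. (real (homology_order S))\<^sup>2)"
      using card_extensional_bijections[OF finite_faces_2 card_faces_2] by simp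
    also have "\<dots> \<le> (\<Sum>s\<in>?B S. (?det s)\<^sup>2)"
    proof (rule sum_mono)
      fix s assume "s \<in> ?B S"
      then have "int (homology_order S) \<le> \<bar>Determinant.det (Matrix.mat N N (\<lambda>(k, j). incidence (s j) (h k)))\<bar>"
        unfolding homology_order_def by (intro homology_bounds(1)[of s 1]) auto
      then have "real (homology_order S) \<le> \<bar>?det s\<bar>"
        unfolding det_of_int by linarith
      then show "(real (homology_order S))\<^sup>2 \<le> (?det s)\<^sup>2"
        by (simp add: abs_le_square_iff[symmetric])
    qed
    finally show ?thesis .
  qed
  have "fact N * (\<Sum>S\<in>?S. (real (homology_order S))\<^sup>2) \<le> (\<Sum>S\<in>?S. \<Sum>s\<in>?B S. (?det s)\<^sup>2)"
    unfolding sum_distrib_left by (rule sum_mono[OF one])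
  also have "\<dots> = (\<Sum>s\<in>(\<Union>S\<in>?S. ?B S). (?det s)\<^sup>2)"
  proof (rule sum.UNION_disjoint[symmetric])
    show "\<forall>S\<in>?S. \<forall>S'\<in>?S. S \<noteq> S' \<longrightarrow> ?B S \<inter> ?B S' = {}"
    proof (intro ballI impI)
      fix S S' assume S: "S \<in> ?S" and S': "S' \<in> ?S" and ne: "S \<noteq> S'"
      have "faces 2 S \<noteq> faces 2 S'"
        using ne hypertree.eq_low_faces_Un[OF hypertree[of S]] hypertree.eq_low_faces_Un[OF hypertree[of S']] S S'
        by (metis (no_types, lifting) mem_Collect_eq)
      then show "?B S \<inter> ?B S' = {}" by (auto simp: bij_betw_def)
    qed
  qed (use finS finB in auto)
  also have "\<dots> \<le> (\<Sum>s\<in>PiE {..<N} (\<lambda>_. \<A>). (?det s)\<^sup>2)"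
  proof (rule sum_mono2)
    show "finite (PiE {..<N} (\<lambda>_. \<A>))" using fin\<A> by (intro finite_PiE) auto
    show "(\<Union>S\<in>?S. ?B S) \<subseteq> PiE {..<N} (\<lambda>_. \<A>)" by (auto simp: PiE_def Pi_def)
  qed simp
  also have "\<dots> = fact N * Determinant.det (Matrix.mat N N
      (\<lambda>(i, j). \<Sum>t\<in>\<A>. real_of_int (incidence t (h i)) * real_of_int (incidence t (h j))))"
    by (rule sum_squared_minors[OF fin\<A>])
  also have "\<dots> \<le> fact N * (\<Prod>k<N. \<Sum>t\<in>\<A>. (real_of_int (incidence t (h k)))\<^sup>2)"
    by (intro mult_left_mono hadamard_gram fin\<A>) simp
  finally show ?thesis by simp
qed

text \<open>A column has at most three nonzero entries, each of absolute value 1, so the squares of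
  all entries sum to at most \<open>3 * N\<close>. The rows may have uneven norms, but by the
  inequality between the means the product of their squares is at most \<open>3 ^ N\<close>.\<close>

lemma det_squared_le:
  assumes S: "S \<in> hypertrees n" and s: "bij_betw s {..<N} (faces 2 S)"
  shows "(real_of_int (Determinant.det (Matrix.mat N N (\<lambda>(k, j). incidence (s j) (h k)))))\<^sup>2 \<le> 3 ^ N"
proof -
  interpret hypertree n S N h by (rule hypertree[OF S])
  have deg: "(\<Sum>k<N. (real_of_int (incidence t (h k)))\<^sup>2) \<le> 3" if t: "card t = 3" for t
  proof -
    have fin: "finite t" using t card.infinite by fastforce
    have "(real_of_int (incidence t (h k)))\<^sup>2 = (if h k \<subseteq> t then 1 else 0)" if "k < N" for k
      using incidence_squared[OF t] h_mem[OF that] by simp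
    then have "(\<Sum>k<N. (real_of_int (incidence t (h k)))\<^sup>2) = real (card {k\<in>{..<N}. h k \<subseteq> t})"
      by (simp add: sum.If_cases Int_def)
    also have "card {k\<in>{..<N}. h k \<subseteq> t} \<le> card {e. e \<subseteq> t \<and> card e = 2}"
    proof (rule card_inj_on_le[where f=h])
      show "inj_on h {k\<in>{..<N}. h k \<subseteq> t}"
        by (rule inj_on_subset[OF bij_betw_imp_inj_on[OF h]]) auto
      show "finite {e. e \<subseteq> t \<and> card e = 2}" using fin by simp
    qed (use h_mem in auto)
    also have "card {e. e \<subseteq> t \<and> card e = 2} = 3"
      using n_subsets[OF fin, of 2] t by (simp add: choose_two)
    finally show ?thesis by simp
  qed
  have sj: "card (s j) = 3" if "j < N" for j
    using faces_2[of "s j"] s that by (auto simp: bij_betw_def)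
  have "(real_of_int (Determinant.det (Matrix.mat N N (\<lambda>(k, j). incidence (s j) (h k)))))\<^sup>2
     \<le> (\<Prod>k<N. \<Sum>j<N. (real_of_int (incidence (s j) (h k)))\<^sup>2)"
    unfolding det_of_int[symmetric] by (rule hadamard_rows)
  also have "\<dots> \<le> 3 ^ card {..<N}"
  proof (rule prod_le_power_3)
    have "(\<Sum>k<N. \<Sum>j<N. (real_of_int (incidence (s j) (h k)))\<^sup>2) = (\<Sum>j<N. \<Sum>k<N. (real_of_int (incidence (s j) (h k)))\<^sup>2)"
      by (rule sum.swap)
    also have "\<dots> \<le> (\<Sum>j<N. 3)" by (intro sum_mono deg sj) simp
    finally show "(\<Sum>k<N. \<Sum>j<N. (real_of_int (incidence (s j) (h k)))\<^sup>2) \<le> 3 * real (card {..<N})" by simp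
  qed (auto intro: sum_nonneg)
  finally show ?thesis by simp
qed

definition cocycles :: "int \<Rightarrow> nat set set \<Rightarrow> (nat \<Rightarrow> int) set" where
  "cocycles m S = {f \<in> PiE {..<N} (\<lambda>_. {0..<m}). \<forall>t\<in>faces 2 S. m dvd (\<Sum>k<N. f k * incidence t (h k))}"

lemma min_generators_bounds:
  assumes S: "S \<in> hypertrees n" and P: "P > 0"
  obtains a b where "min_generators (simplicial_homology_group 1 S) \<le> a + b"
    "real (P + 1) ^ (2 * b) \<le> 3 ^ N" "2 ^ a \<le> card (cocycles (fact P) S)"
proof -
  interpret hypertree n S N h by (rule hypertree[OF S])
  obtain s where s: "bij_betw s {..<N} (faces 2 S)"
    using ex_bij_betw_nat_finite[OF finite_faces_2] by (auto simp: card_faces_2 atLeast0LessThan)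
  let ?\<Delta> = "Determinant.det (Matrix.mat N N (\<lambda>(k, j). incidence (s j) (h k)))"
  obtain a b where ab: "min_generators H \<le> a + b" "int ((P + 1) ^ b) \<le> \<bar>?\<Delta>\<bar>" "2 ^ a \<le> card (cocycles (fact P) S)"
    using homology_bounds(2)[OF s P] unfolding cocycles_def by blast
  have "real (P + 1) ^ b = real_of_int (int ((P + 1) ^ b))" by simp
  also have "\<dots> \<le> \<bar>real_of_int ?\<Delta>\<bar>" using ab(2) by (simp only: of_int_le_iff flip: of_int_abs)
  finally have "(real (P + 1) ^ b)\<^sup>2 \<le> (real_of_int ?\<Delta>)\<^sup>2"
    by (subst abs_le_square_iff[symmetric]) simp
  also have "\<dots> \<le> 3 ^ N" by (rule det_squared_le[OF S s])
  finally have "real (P + 1) ^ (2 * b) \<le> 3 ^ N" by (simp add: power_mult mult.commute)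
  then show ?thesis using that ab by blast
qed

lemma h_mem: "k < N \<Longrightarrow> h k \<subseteq> {2..n} \<and> card (h k) = 2"
  using bij_betwE[OF h] by (auto simp: vertex1_free_edges_def)

text \<open>The left side is Kalai's constant times the expected number of cocycles. After an
  exchange of sums, \<open>f\<close> is a cocycle of \<open>S\<close> exactly if the triangles of
  \<open>S\<close> lie in \<open>\<A> f\<close>, the triangles on which \<open>f\<close> is closed,
  and the degree of an edge in \<open>\<A> f\<close> is its number of good vertices.\<close>

lemma sum_homology_order_squared_cocycles_le:
  fixes m :: int and K :: nat
  assumes m: "m > 0"
  shows "(\<Sum>S\<in>hypertrees n. (real (homology_order S))\<^sup>2 * real (card (cocycles m S)))
     \<le> real n ^ N * (exp (real N * real_of_int m / real (Suc K)) * real n ^ K * real_of_int m ^ (K * n))"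
proof -
  let ?F = "PiE {..<N} (\<lambda>_. {0..<m})"
  have finF: "finite ?F" by (intro finite_PiE) auto
  define ok where "ok f t \<longleftrightarrow> m dvd (\<Sum>l<N. f l * incidence t (h l))" for f t
  define \<A> where "\<A> f = {t. t \<subseteq> {1..n} \<and> card t = 3 \<and> ok f t}" for f
  \<comment> \<open>The vertices of the edge itself are never good, so the sample may be drawn from
    all of \<open>{1..n}\<close>.\<close>
  define good where "good f k v \<longleftrightarrow> v \<in> {1..n} - h k \<and> ok f (insert v (h k))" for f k v

  have card3: "card (insert v (h k)) = 3" if "k < N" "v \<notin> h k" for k v
    using h_mem[OF that(1)] that(2) finite_subset[of "h k" "{2..n}"] by simp

  have degree: "(\<Sum>t\<in>\<A> f. (real_of_int (incidence t (h k)))\<^sup>2) = real (card {v\<in>{1..n}. good f k v})"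
    if k: "k < N" for f k
  proof -
    have finA: "finite (\<A> f)" by (rule finite_subset[of _ "Pow {1..n}"]) (auto simp: \<A>_def)
    have "(real_of_int (incidence t (h k)))\<^sup>2 = (if h k \<subseteq> t then 1 else 0)" if "t \<in> \<A> f" for t
      using incidence_squared[of t "h k"] h_mem[OF k] that by (simp add: \<A>_def)
    then have "(\<Sum>t\<in>\<A> f. (real_of_int (incidence t (h k)))\<^sup>2) = real (card {t\<in>\<A> f. h k \<subseteq> t})"
      using finA by (simp add: sum.If_cases Int_def)
    also have "{t\<in>\<A> f. h k \<subseteq> t} = (\<lambda>v. insert v (h k)) ` {v\<in>{1..n}. good f k v}"
    proof (intro equalityI subsetI)
      fix t assume t: "t \<in> {t\<in>\<A> f. h k \<subseteq> t}"
      then have c: "card t = 3" "finite t" using card.infinite[of t] by (fastforce simp: \<A>_def)+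
      then have "card (t - h k) = 1"
        using t h_mem[OF k] by (subst card_Diff_subset) (auto intro: finite_subset)
      then obtain v where v: "t - h k = {v}" by (rule card_1_singletonE)
      then have "t = insert v (h k)" using t by blast
      moreover have "v \<in> t" "v \<notin> h k" using v by auto
      ultimately show "t \<in> (\<lambda>v. insert v (h k)) ` {v\<in>{1..n}. good f k v}"
        using t by (intro image_eqI[of _ _ v]) (auto simp: \<A>_def good_def)
    next
      fix t assume "t \<in> (\<lambda>v. insert v (h k)) ` {v\<in>{1..n}. good f k v}"
      then obtain v where v: "t = insert v (h k)" "good f k v" "v \<in> {1..n}" by auto
      moreover have "h k \<subseteq> {1..n}" using h_mem[OF k] by auto
      ultimately show "t \<in> {t\<in>\<A> f. h k \<subseteq> t}"
        using card3[OF k, of v] by (auto simp: \<A>_def good_def)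
    qed
    also have "card \<dots> = card {v\<in>{1..n}. good f k v}"
      by (intro card_image inj_onI) (auto simp: good_def)
    finally show ?thesis .
  qed

  have count: "(\<Sum>f\<in>?F. \<Prod>k<N. real (card {v\<in>{1..n}. good f k v}) / real (card {1..n}))
     \<le> exp (real (card {..<N}) * real (card {0..<m}) / real (Suc K)) * real (card {1..n}) ^ K
        * real (card {0..<m}) ^ (K * card {1..n})"
  \<comment> \<open>The triangle on \<open>v\<close> and the edge \<open>h k\<close> has incidence 1
    or -1 with \<open>h k\<close>, so closedness determines \<open>f k\<close> modulo
    \<open>m\<close>. Its other two edges contain \<open>v\<close>, and at most \<open>n\<close>
    edges do.\<close>
  proof (rule sum_prod_good_fraction_le[where touch="\<lambda>k v. v \<in> h k"])
    fix f :: "nat \<Rightarrow> int" and k v a b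
    assume k: "k \<in> {..<N}" and ab: "a \<in> {0..<m}" "b \<in> {0..<m}" and
      g: "good (f(k := a)) k v" "good (f(k := b)) k v"
    let ?i = "\<lambda>l. incidence (insert v (h k)) (h l)"
    have split: "(\<Sum>l<N. (f(k := c)) l * ?i l) = c * ?i k + (\<Sum>l\<in>{..<N} - {k}. f l * ?i l)" for c
      using k by (subst sum.remove[of _ k]) auto
    have "m dvd (a * ?i k + (\<Sum>l\<in>{..<N} - {k}. f l * ?i l)) - (b * ?i k + (\<Sum>l\<in>{..<N} - {k}. f l * ?i l))"
      using g unfolding good_def ok_def split by (intro dvd_diff) auto
    then have "m dvd (a - b) * ?i k" by (simp add: left_diff_distrib)
    moreover have "\<bar>?i k\<bar> = 1"
      using abs_incidence[OF card3[of k v], of "h k"] k g h_mem[of k] by (auto simp: good_def)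
    then have "?i k = 1 \<or> ?i k = - 1" by linarith
    ultimately have "m dvd a - b" by (auto simp: dvd_minus_iff dvd_diff_commute)
    then have "a mod m = b mod m" by (simp add: mod_eq_dvd_iff)
    then show "a = b" using ab by simp
  next
    fix f f' :: "nat \<Rightarrow> int" and k v
    assume k: "k \<in> {..<N}" and eq: "f k = f' k" "\<And>l. l \<in> {..<N} \<Longrightarrow> v \<in> h l \<Longrightarrow> f l = f' l"
    have "(\<Sum>l<N. f l * incidence (insert v (h k)) (h l)) = (\<Sum>l<N. f' l * incidence (insert v (h k)) (h l))"
      if v: "v \<notin> h k"
    proof (rule sum.cong)
      fix l assume l: "l \<in> {..<N}"
      show "f l * incidence (insert v (h k)) (h l) = f' l * incidence (insert v (h k)) (h l)"
      proof (cases "v \<in> h l \<or> l = k")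
        case False
        have "\<not> h l \<subseteq> insert v (h k)"
        proof
          assume "h l \<subseteq> insert v (h k)"
          then have "h l \<subseteq> h k" using False by blast
          moreover have "finite (h k)" using h_mem[of k] k finite_subset by auto
          ultimately have "h l = h k" using h_mem[of k] h_mem[of l] k l by (intro card_subset_eq) auto
          then show False using False k l bij_betw_imp_inj_on[OF h] by (auto simp: inj_on_def)
        qed
        then have "\<bar>incidence (insert v (h k)) (h l)\<bar> = 0"
          using abs_incidence[OF card3[of k v], of "h l"] v k by simp
        then show ?thesis by simp
      qed (use eq l in auto)
    qed simp
    then show "good f k v = good f' k v" by (auto simp: good_def ok_def)
  next
    fix v assume "v \<in> {1..n}"
    have "card {k\<in>{..<N}. v \<in> h k} \<le> card ((\<lambda>w. {v, w}) ` {1..n})"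
    proof (rule card_inj_on_le[where f=h])
      show "inj_on h {k\<in>{..<N}. v \<in> h k}"
        by (rule inj_on_subset[OF bij_betw_imp_inj_on[OF h]]) auto
      show "h ` {k\<in>{..<N}. v \<in> h k} \<subseteq> (\<lambda>w. {v, w}) ` {1..n}"
      proof (rule image_subsetI)
        fix k assume k: "k \<in> {k\<in>{..<N}. v \<in> h k}"
        then obtain x y where xy: "h k = {x, y}" using h_mem[of k] by (auto simp: card_2_iff)
        then have "x \<in> {1..n}" "y \<in> {1..n}" using h_mem[of k] k by auto
        then show "h k \<in> (\<lambda>w. {v, w}) ` {1..n}" using xy k by (auto simp: insert_commute)
      qed
    qed simp
    also have "\<dots> \<le> card {1..n}" by (rule card_image_le) simp
    finally show "card {k\<in>{..<N}. v \<in> h k} \<le> card {1..n}" .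
  qed (use m n in auto)

  have cocycles: "cocycles m S = {f\<in>?F. faces 2 S \<subseteq> \<A> f}" if "S \<in> hypertrees n" for S
  proof -
    interpret hypertree n S N h by (rule hypertree[OF that])
    show ?thesis using faces_2 unfolding cocycles_def \<A>_def ok_def by blast
  qed
  have "(\<Sum>S\<in>hypertrees n. (real (homology_order S))\<^sup>2 * real (card (cocycles m S)))
      = (\<Sum>S\<in>hypertrees n. \<Sum>f\<in>?F. if faces 2 S \<subseteq> \<A> f then (real (homology_order S))\<^sup>2 else 0)"
    using finF by (intro sum.cong) (auto simp: cocycles sum.If_cases Int_def)
  also have "\<dots> = (\<Sum>f\<in>?F. \<Sum>S\<in>hypertrees n. if faces 2 S \<subseteq> \<A> f then (real (homology_order S))\<^sup>2 else 0)"
    by (rule sum.swap)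
  also have "\<dots> = (\<Sum>f\<in>?F. \<Sum>S | S \<in> hypertrees n \<and> faces 2 S \<subseteq> \<A> f. (real (homology_order S))\<^sup>2)"
    by (simp only: sum.inter_filter[OF finite_hypertrees])
  also have "\<dots> \<le> (\<Sum>f\<in>?F. \<Prod>k<N. \<Sum>t\<in>\<A> f. (real_of_int (incidence t (h k)))\<^sup>2)"
    by (intro sum_mono sum_homology_order_squared_le) (simp add: \<A>_def)
  \<comment> \<open>Dividing every degree by \<open>n\<close> extracts the power
    \<open>n ^ N\<close>, to be compared with Kalai's constant.\<close>
  also have "\<dots> = (\<Sum>f\<in>?F. \<Prod>k<N. real n * (real (card {v\<in>{1..n}. good f k v}) / real (card {1..n})))"
    using n by (intro sum.cong prod.cong) (auto simp: degree)
  also have "\<dots> = real n ^ N * (\<Sum>f\<in>?F. \<Prod>k<N. real (card {v\<in>{1..n}. good f k v}) / real (card {1..n}))"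
    by (simp only: prod.distrib prod_constant card_lessThan sum_distrib_left)
  also have "\<dots> \<le> real n ^ N * (exp (real N * real_of_int m / real (Suc K)) * real n ^ K * real_of_int m ^ (K * n))"
    using count m by (intro mult_left_mono) (simp_all add: of_nat_nat)
  finally show ?thesis .
qed

section \<open>Tail bounds and the limit\<close>

text \<open>Markov's inequality for the number of cocycles.\<close>

lemma prob_many_cocycles_le:
  fixes m :: int and K :: nat
  assumes dh: "determinantal_hypertree n M T" and m: "m > 0" and c: "c > 0"
    and B: "B \<subseteq> hypertrees n" "\<And>S. S \<in> B \<Longrightarrow> c \<le> real (card (cocycles m S))"
  shows "measure M {\<omega> \<in> space M. T \<omega> \<in> B}
     \<le> real n ^ N * (exp (real N * real_of_int m / real (Suc K)) * real n ^ K * real_of_int m ^ (K * n))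
        / (c * real n ^ ((n - 2) choose 2))"
proof -
  interpret prob_space M using dh by (simp add: determinantal_hypertree_def)
  have T: "T \<in> measurable M (count_space (hypertrees n))"
    and P: "\<And>S. S \<in> hypertrees n \<Longrightarrow> measure M {\<omega> \<in> space M. T \<omega> = S}
        = (real (homology_order S))\<^sup>2 / real n ^ ((n - 2) choose 2)"
    using dh by (auto simp: determinantal_hypertree_def homology_order_def)
  let ?Z = "real n ^ ((n - 2) choose 2)"
  have Z: "?Z > 0" using n by simp
  have finB: "finite B" using B(1) finite_hypertrees finite_subset by blast
  have "{\<omega> \<in> space M. T \<omega> \<in> B} = (\<Union>S\<in>B. {\<omega> \<in> space M. T \<omega> = S})" by auto
  then have "measure M {\<omega> \<in> space M. T \<omega> \<in> B} = measure M (\<Union>S\<in>B. {\<omega> \<in> space M. T \<omega> = S})" by simp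
  also have "\<dots> = (\<Sum>S\<in>B. measure M {\<omega> \<in> space M. T \<omega> = S})"
  proof (rule finite_measure_finite_Union[OF finB])
    show "(\<lambda>S. {\<omega> \<in> space M. T \<omega> = S}) ` B \<subseteq> sets M"
    proof (rule image_subsetI)
      fix S assume "S \<in> B"
      then have "T -` {S} \<inter> space M \<in> sets M"
        using B(1) by (intro measurable_sets[OF T]) auto
      also have "T -` {S} \<inter> space M = {\<omega> \<in> space M. T \<omega> = S}" by auto
      finally show "{\<omega> \<in> space M. T \<omega> = S} \<in> sets M" .
    qed
  qed (auto simp: disjoint_family_on_def)
  also have "\<dots> \<le> (\<Sum>S\<in>B. (real (homology_order S))\<^sup>2 * real (card (cocycles m S)) / (c * ?Z))"
  proof (rule sum_mono)
    fix S assume S: "S \<in> B"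
    have "c * (real (homology_order S))\<^sup>2 \<le> real (card (cocycles m S)) * (real (homology_order S))\<^sup>2"
      using B(2)[OF S] by (rule mult_right_mono) simp
    then have "c * (real (homology_order S))\<^sup>2 / (c * ?Z) \<le> (real (homology_order S))\<^sup>2 * real (card (cocycles m S)) / (c * ?Z)"
      using c Z by (intro divide_right_mono) (auto simp: mult.commute)
    moreover have "measure M {\<omega> \<in> space M. T \<omega> = S} = c * (real (homology_order S))\<^sup>2 / (c * ?Z)"
      using P[of S] S B(1) c by auto
    ultimately show "measure M {\<omega> \<in> space M. T \<omega> = S} \<le> (real (homology_order S))\<^sup>2 * real (card (cocycles m S)) / (c * ?Z)"
      by simp
  qed
  also have "\<dots> \<le> (\<Sum>S\<in>hypertrees n. (real (homology_order S))\<^sup>2 * real (card (cocycles m S)) / (c * ?Z))"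
    using B(1) finite_hypertrees c Z by (intro sum_mono2) auto
  also have "\<dots> = (\<Sum>S\<in>hypertrees n. (real (homology_order S))\<^sup>2 * real (card (cocycles m S))) / (c * ?Z)"
    by (simp add: sum_divide_distrib)
  also have "\<dots> \<le> real n ^ N * (exp (real N * real_of_int m / real (Suc K)) * real n ^ K * real_of_int m ^ (K * n)) / (c * ?Z)"
    using c Z sum_homology_order_squared_cocycles_le[OF m, of K] by (intro divide_right_mono) auto
  finally show ?thesis .
qed

end

text \<open>The condition on \<open>P\<close> makes the determinant account for at most
  \<open>\<epsilon> * n^2 / 2\<close> generators. The other half forces at least
  \<open>exp (\<delta> * n^2)\<close> cocycles. The condition on \<open>K\<close> keeps the
  prediction error below \<open>exp (\<delta> / 2 * n^2)\<close>, so half of the exponent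
  survives.\<close>

lemma prob_many_generators_le:
  fixes \<epsilon> \<delta> :: real and P K n :: nat
  assumes dh: "determinantal_hypertree n M T" and n3: "n \<ge> 3" and P: "P > 0"
    and P_large: "ln 3 \<le> 2 * \<epsilon> * ln (real (P + 1))"
    and \<delta>: "\<delta> = \<epsilon> / 2 * ln 2" and K: "fact P / real (Suc K) \<le> \<delta>"
  shows "measure M {\<omega> \<in> space M. real (min_generators (simplicial_homology_group 1 (T \<omega>))) > \<epsilon> * (real n)\<^sup>2}
     \<le> exp ((real n + real K) * ln (real n) + real K * real n * ln (fact P) - \<delta> / 2 * (real n)\<^sup>2)"
proof -
  define N where "N = (n - 1) choose 2"
  define C where "C = (n - 2) choose 2"
  have "card (vertex1_free_edges n) = N" using n3 by (simp add: N_def card_vertex1_free_edges)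
  then obtain h where "bij_betw h {..<N} (vertex1_free_edges n)"
    using ex_bij_betw_nat_finite[OF finite_vertex1_free_edges, of n] by (auto simp: atLeast0LessThan)
  then interpret enumeration n N h using n3 by unfold_locales auto
  \<comment> \<open>The exponents of \<open>n\<close> from Hadamard's inequality and from Kalai's
    formula differ by \<open>n - 2\<close> only, which costs exp(O(n log n)).\<close>
  have NC: "N = C + (n - 2)"
  proof -
    have "Suc k choose 2 = (k choose 2) + k" for k
      by (simp add: eval_nat_numeral)
    moreover have "Suc (n - 2) = n - 1" using n3 by simp
    ultimately show ?thesis unfolding N_def C_def by metis
  qed
  have N2: "2 * real N \<le> (real n)\<^sup>2"
  proof -
    have "2 * N \<le> (n - 1) * (n - 1 - 1)" unfolding N_def choose_two by simp
    also have "\<dots> \<le> n * n" by (intro mult_mono) auto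
    finally have "real (2 * N) \<le> real (n * n)" by (simp only: of_nat_le_iff)
    then show ?thesis by (simp add: power2_eq_square)
  qed
  have lnP: "ln (real (P + 1)) > 0" using P by simp
  have "0 < 2 * \<epsilon> * ln (real (P + 1))" using P_large by (rule less_le_trans[rotated]) simp
  then have \<epsilon>: "\<epsilon> > 0" using lnP by (simp add: zero_less_mult_iff)
  let ?mg = "\<lambda>S. real (min_generators (simplicial_homology_group 1 S))"
  define B where "B = {S \<in> hypertrees n. ?mg S > \<epsilon> * (real n)\<^sup>2}"
  have cocycles_ge: "exp (\<delta> * (real n)\<^sup>2) \<le> real (card (cocycles (fact P) S))" if S: "S \<in> B" for S
  proof -
    obtain a b where ab: "min_generators (simplicial_homology_group 1 S) \<le> a + b"
        "real (P + 1) ^ (2 * b) \<le> 3 ^ N" "2 ^ a \<le> card (cocycles (fact P) S)"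
      using min_generators_bounds[of S P] S P by (auto simp: B_def)
    have "ln (real (P + 1) ^ (2 * b)) \<le> ln (3 ^ N)"
      using ab(2) P by (subst ln_le_cancel_iff) auto
    then have "2 * real b * ln (real (P + 1)) \<le> real N * ln 3"
      by (simp add: ln_realpow del: of_nat_add)
    also have "\<dots> \<le> real N * (2 * \<epsilon> * ln (real (P + 1)))"
      using P_large by (rule mult_left_mono) simp
    finally have "(2 * real b) * ln (real (P + 1)) \<le> (2 * real N * \<epsilon>) * ln (real (P + 1))"
      by (simp only: mult_ac)
    then have "2 * real b \<le> 2 * real N * \<epsilon>" using lnP by simp
    also have "\<dots> \<le> (real n)\<^sup>2 * \<epsilon>" using N2 \<epsilon> by (intro mult_right_mono) auto
    finally have "real b \<le> \<epsilon> * (real n)\<^sup>2 / 2" by (simp add: mult.commute)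
    moreover have "\<epsilon> * (real n)\<^sup>2 < real a + real b" using ab(1) S by (simp add: B_def flip: of_nat_add)
    ultimately have "\<epsilon> * (real n)\<^sup>2 / 2 \<le> real a" by simp
    then have "\<delta> * (real n)\<^sup>2 \<le> real a * ln 2"
      unfolding \<delta> using mult_right_mono[of "\<epsilon> * (real n)\<^sup>2 / 2" "real a" "ln 2"] by (simp add: mult_ac)
    then have "exp (\<delta> * (real n)\<^sup>2) \<le> exp (real a * ln 2)" by simp
    also have "\<dots> = 2 ^ a" by (simp add: exp_of_nat_mult)
    also have "\<dots> \<le> real (card (cocycles (fact P) S))" using ab(3) by (metis of_nat_le_iff of_nat_numeral of_nat_power)
    finally show ?thesis .
  qed
  have "T \<omega> \<in> hypertrees n" if "\<omega> \<in> space M" for \<omega>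
    using dh measurable_space[of T M "count_space (hypertrees n)"] that by (auto simp: determinantal_hypertree_def)
  then have "{\<omega> \<in> space M. ?mg (T \<omega>) > \<epsilon> * (real n)\<^sup>2} = {\<omega> \<in> space M. T \<omega> \<in> B}"
    by (auto simp: B_def)
  then have "measure M {\<omega> \<in> space M. ?mg (T \<omega>) > \<epsilon> * (real n)\<^sup>2} = measure M {\<omega> \<in> space M. T \<omega> \<in> B}" by simp
  also have "\<dots> \<le> real n ^ N * (exp (real N * real_of_int (fact P) / real (Suc K)) * real n ^ K * real_of_int (fact P) ^ (K * n))
        / (exp (\<delta> * (real n)\<^sup>2) * real n ^ ((n - 2) choose 2))"
    by (rule prob_many_cocycles_le[OF dh]) (use cocycles_ge in \<open>auto simp: B_def\<close>)
  also have "\<dots> = real n ^ (n - 2) * (exp (real N * (fact P / real (Suc K))) * (real n ^ K * fact P ^ (K * n))) / exp (\<delta> * (real n)\<^sup>2)"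
  proof -
    have "real n ^ N = real n ^ C * real n ^ (n - 2)" unfolding NC by (rule power_add)
    moreover have "real n ^ C \<noteq> 0" using n3 by simp
    ultimately show ?thesis using n3 by (simp flip: C_def del: of_nat_Suc)
  qed
  also have "\<dots> \<le> real n ^ n * (exp (\<delta> / 2 * (real n)\<^sup>2) * (real n ^ K * fact P ^ (K * n))) / exp (\<delta> * (real n)\<^sup>2)"
  proof -
    have pow: "real n ^ (n - 2) \<le> real n ^ n" using n3 by (intro power_increasing) auto
    have \<delta>0: "\<delta> \<ge> 0" using \<epsilon> by (simp add: \<delta>)
    have "real N * (fact P / real (Suc K)) \<le> real N * \<delta>" using K by (rule mult_left_mono) simp
    also have "\<dots> \<le> \<delta> / 2 * (real n)\<^sup>2" using mult_right_mono[OF N2 \<delta>0] by (simp add: mult_ac)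
    finally have "exp (real N * (fact P / real (Suc K))) \<le> exp (\<delta> / 2 * (real n)\<^sup>2)"
      by (simp only: exp_le_cancel_iff)
    then have "exp (real N * (fact P / real (Suc K))) * (real n ^ K * fact P ^ (K * n))
        \<le> exp (\<delta> / 2 * (real n)\<^sup>2) * (real n ^ K * fact P ^ (K * n))"
      by (rule mult_right_mono) simp
    from mult_mono[OF pow this] show ?thesis by (rule divide_right_mono) simp_all
  qed
  also have "\<dots> = exp ((real n + real K) * ln (real n) + real K * real n * ln (fact P) - \<delta> / 2 * (real n)\<^sup>2)"
  proof -
    have "real n ^ j = exp (real j * ln (real n))" for j using n3 by (simp add: exp_of_nat_mult)
    moreover have "fact P ^ (K * n) = exp (real K * real n * ln (fact P))"
      using exp_of_nat_mult[of "K * n" "ln (fact P :: real)"] by simp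
    ultimately have "real n ^ n * (exp (\<delta> / 2 * (real n)\<^sup>2) * (real n ^ K * fact P ^ (K * n))) / exp (\<delta> * (real n)\<^sup>2)
      = exp (real n * ln (real n) + (\<delta> / 2 * (real n)\<^sup>2 + (real K * ln (real n) + real K * real n * ln (fact P))) - \<delta> * (real n)\<^sup>2)"
      by (simp only: exp_add exp_diff)
    then show ?thesis by (simp add: algebra_simps)
  qed
  finally show ?thesis .
qed

theorem corollary3:
  fixes M :: "nat \<Rightarrow> 'a measure" and T :: "nat \<Rightarrow> 'a \<Rightarrow> nat set set"
  assumes "\<And>n. n \<ge> 1 \<Longrightarrow> determinantal_hypertree n (M n) (T n)"
  shows "tends_in_probability M
           (\<lambda>n \<omega>. real (min_generators (simplicial_homology_group 1 (T n \<omega>))) / real n ^ 2) 0"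
  unfolding tends_in_probability_def
proof (intro allI impI)
  fix \<epsilon> :: real assume \<epsilon>: "\<epsilon> > 0"
  define \<delta> where "\<delta> = \<epsilon> / 2 * ln 2"
  have \<delta>: "\<delta> > 0" using \<epsilon> by (simp add: \<delta>_def)
  define P where "P = nat \<lceil>exp (ln 3 / (2 * \<epsilon>))\<rceil>"
  have P_ge: "exp (ln 3 / (2 * \<epsilon>)) \<le> real P" unfolding P_def by linarith
  then have P: "P > 0" by (metis exp_gt_zero not_le of_nat_0 gr0I)
  have "ln 3 / (2 * \<epsilon>) = ln (exp (ln 3 / (2 * \<epsilon>)))" by simp
  also have "\<dots> \<le> ln (real (P + 1))" using P_ge by (subst ln_le_cancel_iff) auto
  finally have P_large: "ln 3 \<le> 2 * \<epsilon> * ln (real (P + 1))"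
    using \<epsilon> by (simp add: field_simps)
  \<comment> \<open>Both \<open>P\<close> and \<open>K\<close> depend only on
    \<open>\<epsilon>\<close>, so every term of the exponent that involves \<open>K\<close> is O(n
    log n).\<close>
  define K where "K = nat \<lceil>fact P / \<delta>\<rceil>"
  have "fact P / \<delta> \<le> real (Suc K)" unfolding K_def by linarith
  then have K: "fact P / real (Suc K) \<le> \<delta>" using \<delta> by (simp add: field_simps del: of_nat_Suc)
  let ?X = "\<lambda>n. measure (M n) {\<omega> \<in> space (M n). \<epsilon> < \<bar>real (min_generators (simplicial_homology_group 1 (T n \<omega>))) / (real n)\<^sup>2 - 0\<bar>}"
  let ?b = "\<lambda>n::nat. exp ((real n + real K) * ln (real n) + real K * real n * ln (fact P) - \<delta> / 2 * (real n)\<^sup>2)"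
  show "?X \<longlonglongrightarrow> 0"
  proof (rule real_tendsto_sandwich)
    show "(\<lambda>n. 0::real) \<longlonglongrightarrow> 0" by simp
    show "?b \<longlonglongrightarrow> 0" using \<delta> by real_asymp
    show "\<forall>\<^sub>F n in sequentially. ?X n \<le> ?b n"
    proof (rule eventually_mono[OF eventually_ge_at_top[of 3]])
      fix n :: nat assume n: "n \<ge> 3"
      have "{\<omega> \<in> space (M n). \<epsilon> < \<bar>real (min_generators (simplicial_homology_group 1 (T n \<omega>))) / (real n)\<^sup>2 - 0\<bar>}
          = {\<omega> \<in> space (M n). real (min_generators (simplicial_homology_group 1 (T n \<omega>))) > \<epsilon> * (real n)\<^sup>2}"
        using n by (simp add: field_simps)
      then show "?X n \<le> ?b n"
        using prob_many_generators_le[OF assms n P P_large \<delta>_def K] n by simp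
    qed
  qed simp
qed

end
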